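(* Let $d>0$. For every compact set $\mathcal K\subset(0,\infty)^2$ not containing the equilibrium $L$, there exists a number $\delta(\mathcal K)>0$ such that for every point $M\in\mathcal K$ and every neighborhood $W$ of $M$ there exists $M'\in W$ such that $\mathrm{dist}\big(F^n(M),F^n(M')\big)\geq\delta(\mathcal K)$ for infinitely many integers $n$.
   Context: The map $F:(0,\infty)^2\to(0,\infty)^2$ is $F(x,y)=\Big(\frac{y+d}{xy},\ \frac{dxy+y+d}{y(y+d)}\Big)$. Its unique fixed point is $L=(\ell,\ell)$, where $\ell>0$ is the unique positive solution of $t^3-t-d=0$. $\mathrm{dist}$ denotes the Euclidean distance in $(0,\infty)^2$. *)

theory Defs
  imports "HOL-Analysis.Analysis"
begin

definition quadrant :: "(real \<times> real) set" where
  "quadrant = {0<..} \<times> {0<..}"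

(* F d preserves quadrant; its values outside quadrant are irrelevant. *)
definition F :: "real \<Rightarrow> real \<times> real \<Rightarrow> real \<times> real" where
  "F d = (\<lambda>(x, y). ((y + d) / (x * y), (d * x * y + y + d) / (y * (y + d))))"

definition ell :: "real \<Rightarrow> real" where
  "ell d = (THE t. 0 < t \<and> t ^ 3 - t - d = 0)"

definition L :: "real \<Rightarrow> real \<times> real" where
  "L d = (ell d, ell d)"

lemma F_quadrant: "0 < d \<Longrightarrow> p \<in> quadrant \<Longrightarrow> F d p \<in> quadrant"
  by (auto simp: F_def quadrant_def intro!: divide_pos_pos mult_pos_pos add_pos_pos)

lemma ell_ex1:
  fixes d :: real
  assumes "0 < d"
  shows "\<exists>!t. 0 < t \<and> t ^ 3 - t - d = 0"
proof -
  have "\<exists>t\<ge>0. t \<le> 1 + d \<and> t ^ 3 - t - d = 0"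
  proof (rule IVT')
    show "0 ^ 3 - 0 - d \<le> 0" using assms by simp
    show "0 \<le> (1 + d) ^ 3 - (1 + d) - d"
      using assms by (simp add: power3_eq_cube algebra_simps)
    show "0 \<le> 1 + d" using assms by simp
    show "continuous_on {0..1 + d} (\<lambda>t. t ^ 3 - t - d)" by (intro continuous_intros)
  qed
  then obtain t where t: "0 \<le> t" "t ^ 3 - t - d = 0" by blast
  have "t \<noteq> 0" using t(2) assms by auto
  with t have t': "0 < t \<and> t ^ 3 - t - d = 0" by simp
  have gt1: "1 < s" if "0 < s" "s ^ 3 - s - d = 0" for s :: real
  proof (rule ccontr)
    assume "\<not> 1 < s"
    then have "s ^ 3 \<le> s ^ 1" using that by (intro power_decreasing) auto
    then show False using that assms by simp
  qed
  have "s = t" if s: "0 < s \<and> s ^ 3 - s - d = 0" for s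
  proof -
    have g: "1 < s" "1 < t" using gt1 s t' by auto
    have "(s - t) * (s * s + s * t + t * t - 1) = (s ^ 3 - s - d) - (t ^ 3 - t - d)"
      by (simp add: power3_eq_cube algebra_simps)
    then have "(s - t) * (s * s + s * t + t * t - 1) = 0" using s t' by simp
    moreover have "1 < s * s" "0 < s * t" "0 < t * t"
      using g by (auto simp: less_1_mult)
    ultimately show "s = t" by auto
  qed
  with t' show ?thesis by blast
qed

lemma ell_pos: "0 < d \<Longrightarrow> 0 < ell d"
  and ell_eq: "0 < d \<Longrightarrow> ell d ^ 3 - ell d - d = 0"
  using theI'[OF ell_ex1, of d] by (auto simp: ell_def)

lemma F_L:
  assumes "0 < d"
  shows "F d (L d) = L d"
proof -
  define l where "l = ell d"
  have l: "0 < l" "d = l ^ 3 - l" using ell_pos[OF assms] ell_eq[OF assms] by (auto simp: l_def)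
  show ?thesis
    unfolding L_def F_def l_def[symmetric] using l(1)
    by (simp add: l(2) field_simps power3_eq_cube)
qed

end

theory Submission
  imports Defs "HOL-Complex_Analysis.Complex_Analysis"
begin

text \<open>The map \<open>F d\<close> is the square of \<open>T (x, y) = (y, (y + d) / (x y))\<close>, which preserves the energy
\<open>H (x, y) = x + y + 1 / x + 1 / y + d / (x y)\<close>. Apart from the equilibrium, its level curves \<open>H = k\<close> in
the quadrant are ovals of elliptic curves, on which \<open>T\<close> acts as a translation. The proof shows that \<open>F d\<close> turns the ovals
like a rotation whose angle is not constant on any interval of levels; nearby points on different
levels then get out of phase.

\<^emph>\<open>The rotation.\<close> In the coordinates \<open>v = x y + 1\<close>, \<open>Y = (y - x) v\<close> the level curve is
\<open>Y\<^sup>2 = C v\<close> with a cubic \<open>C\<close>, and \<open>v' = Y\<close>, \<open>Y' = C' v / 2\<close> defines a vector field that is invariant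
under all translations of the group law (\<open>chord_solves\<close>); in the coordinates \<open>x, y\<close> it has the same
expression on all levels (\<open>xy_coords_solves\<close>). Adding the point \<open>(s, sqrt (C s))\<close> while \<open>s\<close>
increases with speed \<open>sqrt (C s)\<close> therefore moves a point of the oval along the flow. The points of this
branch at \<open>s = - d (k + d)\<close>, \<open>s = 0\<close> and \<open>s = 1\<close> are \<open>-3\<close>, \<open>1\<close> and \<open>-2\<close> times the translation that
defines \<open>T\<close> (\<open>chord_step_m3\<close>, \<open>chord_step\<close>, \<open>chord_step_m2\<close>). If \<open>A\<close> and \<open>B\<close> denote the integrals of
\<open>1 / sqrt C\<close> from \<open>- d (k + d)\<close> to \<open>0\<close> and from \<open>0\<close> to \<open>1\<close>, then the flow for the time \<open>A\<close> is \<open>T\<^sup>4\<close> and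
for the time \<open>A + B\<close> it is \<open>T\<close> (\<open>trajectory_over_one_step\<close>). Hence \<open>4 (A + B) - A = 3 A + 4 B\<close> is a
return time of the flow on the whole level, and \<open>F d\<close> advances by the fraction
\<open>2 (A + B) / (3 A + 4 B)\<close> of it.

\<^emph>\<open>The twist.\<close> If this fraction were constant on an interval of levels, then \<open>A = c B\<close> there with
\<open>c > 0\<close>. After substitutions that make the limits of integration independent of \<open>k\<close>, both integrals
are real analytic for \<open>k > - d\<close>, although only positive \<open>k\<close> are levels. So \<open>A = c B\<close> would
hold for all \<open>k > - d\<close> to the left of the interval. But for \<open>k\<close> tending to \<open>- d\<close> the integral \<open>A\<close> stays
bounded while \<open>B\<close> tends to infinity (\<open>left_right_ratio_nonconstant\<close>).

\<^emph>\<open>Sensitivity.\<close> For an irrational \<open>\<theta>\<close>, flowing for \<open>\<theta>\<close> times the return time moves every point other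
than the equilibrium: return times are closed under subtraction, so otherwise some of them would be
arbitrarily small. By compactness this displacement has a positive lower bound on all orbits that
start in \<open>K\<close>. If two nearby points have slightly different rotation fractions, their phase difference
grows slowly and linearly, so it is close to \<open>\<theta>\<close> modulo \<open>1\<close> infinitely often
(\<open>sensitivity_of_twisted_rotation\<close>).\<close>

section \<open>The half step and its conserved energy\<close>

text \<open>The recurrence \<open>u (n + 1) * u (n - 1) = 1 + d / u n\<close>, as a map of pairs of consecutive terms.\<close>
definition step :: "real \<Rightarrow> real \<times> real \<Rightarrow> real \<times> real" where
  "step d = (\<lambda>(x, y). (y, (y + d) / (x * y)))"

text \<open>As a function of \<open>x\<close> this is \<open>x + c / x\<close> plus a constant, where \<open>c = 1 + d / y\<close>; so it does not change
when \<open>x\<close> is replaced by \<open>c / x\<close>, and it is symmetric. The map \<open>step\<close> is composed of these two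
involutions.\<close>
definition energy :: "real \<Rightarrow> real \<times> real \<Rightarrow> real" where
  "energy d = (\<lambda>(x, y). x + y + 1 / x + 1 / y + d / (x * y))"

text \<open>The relation \<open>x * y * z = y + d\<close> takes the place of the division in \<open>step\<close>: with it, identities
between iterates become consequences of polynomial equations.\<close>
lemma step_pair:
  assumes "0 < x" "0 < y" "0 < d"
  obtains z where "step d (x, y) = (y, z)" "0 < z" "x * y * z = y + d"
  using assms that[of "(y + d) / (x * y)"] by (simp add: step_def)

lemma energy_eq_iff:
  assumes "0 < x" "0 < y"
  shows "energy d (x, y) = k \<longleftrightarrow> k * x * y = x * y * (x + y) + x + y + d"
  using assms by (auto simp: energy_def field_simps)

lemma F_eq_step_step:
  assumes "0 < d" "p \<in> quadrant" shows "F d p = step d (step d p)"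
proof -
  obtain x y where p: "p = (x, y)" "0 < x" "0 < y"
    using assms by (auto simp: quadrant_def)
  obtain z where z: "step d (x, y) = (y, z)" "0 < z" "x * y * z = y + d"
    using step_pair p assms(1) by metis
  obtain w where w: "step d (y, z) = (z, w)" "0 < w" "y * z * w = z + d"
    using step_pair p z assms(1) by metis
  have "0 < y + d" using assms p by simp
  have "(y * (y + d)) * w = d * x * y + y + d" using z(3) w(3) by algebra
  then have "w = (d * x * y + y + d) / (y * (y + d))"
    using p \<open>0 < y + d\<close> by (metis eq_divide_eq mult.commute mult_pos_pos less_irrefl)
  moreover have "z = (y + d) / (x * y)" using z(3) p by (simp add: field_simps)
  ultimately show ?thesis using w(1) z(1) p by (simp add: F_def)
qed

lemma step_quadrant: "0 < d \<Longrightarrow> p \<in> quadrant \<Longrightarrow> step d p \<in> quadrant"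
  by (auto simp: step_def quadrant_def intro!: divide_pos_pos mult_pos_pos add_pos_pos)

lemma energy_step:
  assumes "0 < d" "p \<in> quadrant" shows "energy d (step d p) = energy d p"
proof -
  obtain x y where p: "p = (x, y)" "0 < x" "0 < y"
    using assms by (auto simp: quadrant_def)
  obtain z where z: "step d (x, y) = (y, z)" "0 < z" "x * y * z = y + d"
    using step_pair p assms(1) by metis
  define k where "k = energy d p"
  have "k * x * y = x * y * (x + y) + x + y + d"
    using p energy_eq_iff k_def by blast
  then have "x * (k * y * z) = x * (y * z * (y + z) + y + z + d)" using z(3) by algebra
  then have "energy d (y, z) = k" using p z energy_eq_iff by simp
  then show ?thesis using p z k_def by simp
qed

lemma step_inj:
  assumes "0 < d" "p \<in> quadrant" "q \<in> quadrant" "step d p = step d q" shows "p = q"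
proof -
  obtain x y where p: "p = (x, y)" "0 < x" "0 < y"
    using assms by (auto simp: quadrant_def)
  obtain x' y' where q: "q = (x', y')" "0 < x'" "0 < y'"
    using assms by (auto simp: quadrant_def)
  have y: "y = y'" and z: "(y + d) / (x * y) = (y + d) / (x' * y)"
    using assms(4) by (auto simp: p q step_def)
  have "0 < y + d" using assms p by simp
  then have "x = x'" using z p q by (simp add: divide_simps)
  then show ?thesis using y p q by simp
qed

lemma energy_pos: "0 < d \<Longrightarrow> p \<in> quadrant \<Longrightarrow> 0 < energy d p"
  by (auto simp: energy_def quadrant_def intro!: add_pos_pos)

lemma continuous_on_energy: "continuous_on quadrant (energy d)"
  unfolding energy_def[abs_def] quadrant_def
  by (auto intro!: continuous_intros simp: case_prod_unfold)

section \<open>Level curves as ovals of cubic curves\<close>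

text \<open>The level curve \<open>energy d p = k\<close> is \<open>Y\<^sup>2 = cubic d k v\<close> in the coordinates of \<open>cubic_coords\<close> below.
Its right-hand side is \<open>-4 v\<^sup>3 + (k\<^sup>2 + 4) v\<^sup>2 - 2 k (k + d) v + (k + d)\<^sup>2\<close>.\<close>
definition cubic :: "real \<Rightarrow> real \<Rightarrow> real \<Rightarrow> real" where
  "cubic d k v = (k * v - (k + d))\<^sup>2 + 4 * v\<^sup>2 * (1 - v)"

text \<open>Half the derivative of \<open>cubic\<close> in \<open>v\<close>: along a motion \<open>v' = Y\<close> on the curve \<open>Y\<^sup>2 = cubic d k v\<close> it is
the derivative of \<open>Y\<close>.\<close>
definition half_slope :: "real \<Rightarrow> real \<Rightarrow> real \<Rightarrow> real" where
  "half_slope d k v = k * (k * v - (k + d)) + 4 * v - 6 * v\<^sup>2"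

lemma cubic_pos: assumes "0 < d" "0 < k" "v \<le> 1" shows "0 < cubic d k v"
proof (cases "v = 0 \<or> v = 1")
  case True then show ?thesis using assms by (auto simp: cubic_def)
next
  case False
  then have "0 < 4 * v\<^sup>2 * (1 - v)" using assms by simp
  then show ?thesis by (simp add: cubic_def add_nonneg_pos)
qed

definition cubic_coords :: "real \<times> real \<Rightarrow> real \<times> real" where
  "cubic_coords = (\<lambda>(x, y). (x * y + 1, (y - x) * (x * y + 1)))"

text \<open>On the level \<open>k\<close> one has \<open>x + y = (k v - (k + d)) / v\<close> and \<open>y - x = Y / v\<close>, so \<open>v\<close> and \<open>Y\<close> determine
the point, and \<open>(x + y)\<^sup>2 - (y - x)\<^sup>2 = 4 x y\<close> is the equation of the cubic. The two inequalities single
out the oval among the real points of the cubic.\<close>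
lemma cubic_coords_on_oval:
  assumes "0 < d" "p \<in> quadrant" "cubic_coords p = (v, Y)" "k = energy d p"
  shows "Y\<^sup>2 = cubic d k v" "1 < v" "k + d < k * v"
   "p = ((k * v - (k + d) - Y) / (2 * v), (k * v - (k + d) + Y) / (2 * v))"
proof -
  obtain x y where p: "p = (x, y)" "0 < x" "0 < y"
    using assms by (auto simp: quadrant_def)
  have v: "v = x * y + 1" "Y = (y - x) * v" using assms p by (auto simp: cubic_coords_def)
  have k: "k * x * y = x * y * (x + y) + x + y + d"
    using p assms by (simp add: energy_def field_simps)
  have kv: "k * v - (k + d) = (x + y) * v" using k unfolding v by algebra
  show "Y\<^sup>2 = cubic d k v" unfolding cubic_def kv unfolding v by algebra
  show v1: "1 < v" using v p by simp
  have "0 < (x + y) * v" using v1 p by simp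
  then show "k + d < k * v" using kv by linarith
  show "p = ((k * v - (k + d) - Y) / (2 * v), (k * v - (k + d) + Y) / (2 * v))"
  proof -
    have "(x + y) * v - Y = 2 * v * x" "(x + y) * v + Y = 2 * v * y"
      by (simp_all add: v(2) algebra_simps)
    then show ?thesis unfolding kv using v1 p by simp
  qed
qed

text \<open>The inverse of \<open>cubic_coords\<close> on the level \<open>k\<close>.\<close>
definition xy_coords :: "real \<Rightarrow> real \<Rightarrow> real \<times> real \<Rightarrow> real \<times> real" where
  "xy_coords d k = (\<lambda>(v, Y). ((k * v - (k + d) - Y) / (2 * v), (k * v - (k + d) + Y) / (2 * v)))"

text \<open>Here \<open>x y = v - 1\<close> and \<open>v (x + y) = k v - (k + d)\<close> are positive, hence so are \<open>x\<close> and \<open>y\<close>.\<close>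
lemma oval_point_in_quadrant:
  assumes "Y\<^sup>2 = cubic d k v" "1 < v" "k + d < k * v" "0 < d"
  shows "xy_coords d k (v, Y) \<in> quadrant" "energy d (xy_coords d k (v, Y)) = k" "cubic_coords (xy_coords d k (v, Y)) = (v, Y)"
proof -
  define x y where "x = (k * v - (k + d) - Y) / (2 * v)" and "y = (k * v - (k + d) + Y) / (2 * v)"
  have u: "xy_coords d k (v, Y) = (x, y)" by (simp add: xy_coords_def x_def y_def)
  have xy: "2 * v * x = k * v - (k + d) - Y" "2 * v * y = k * v - (k + d) + Y"
    using assms by (simp_all add: x_def y_def)
  have "(4 * v\<^sup>2) * (x * y) = (4 * v\<^sup>2) * (v - 1)"
    using xy assms(1) unfolding cubic_def by algebra
  then have p: "x * y = v - 1" using assms by simp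
  have vs: "v * (x + y) = k * v - (k + d)" using xy by algebra
  then have "0 < v * (x + y)" using assms(3) by simp
  then have "0 < x + y" by (rule zero_less_mult_pos) (use assms(2) in simp)
  have s: "k * x * y = x * y * (x + y) + x + y + d" using vs p by algebra
  have "0 < x * y" using p assms by simp
  then have pos: "0 < x" "0 < y" using \<open>0 < x + y\<close> by (auto simp: zero_less_mult_iff)
  show "xy_coords d k (v, Y) \<in> quadrant" using pos by (simp add: u quadrant_def)
  show "energy d (xy_coords d k (v, Y)) = k" using pos s by (simp add: u energy_eq_iff)
  have "2 * v * (y - x) = 2 * Y" using xy by algebra
  then show "cubic_coords (xy_coords d k (v, Y)) = (v, Y)" using p by (simp add: u cubic_coords_def mult.commute)
qed

text \<open>The region \<open>v > 1\<close>, \<open>k v > k + d\<close> is open and closed on the curve: at \<open>v = 1\<close> the second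
expression \<open>k v - (k + d)\<close> is \<open>- d < 0\<close>, and where it vanishes with \<open>v > 1\<close> the cubic is negative. A
connected path cannot leave such a region.\<close>
lemma oval_persists:
  fixes v :: "real \<Rightarrow> real"
  assumes "continuous_on {0..T} v" "\<And>t. t \<in> {0..T} \<Longrightarrow> 0 \<le> cubic d k (v t)"
    and "1 < v 0" "k + d < k * v 0" "0 < d" "t \<in> {0..T}"
  shows "1 < v t \<and> k + d < k * v t"
proof -
  let ?A = "{t \<in> {0..T}. 1 < v t \<and> k + d < k * v t}"
  let ?B = "{t \<in> {0..T}. 1 \<le> v t \<and> k + d \<le> k * v t}"
  have eq: "?A = ?B"
  proof -
    have False if t: "t \<in> {0..T}" "1 \<le> v t" "k + d \<le> k * v t" "\<not> (1 < v t \<and> k + d < k * v t)" for t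
    proof (cases "v t = 1")
      case True then show False using t \<open>0 < d\<close> by simp
    next
      case False
      then have v: "1 < v t" "k * v t = k + d" using t by auto
      have "cubic d k (v t) = 4 * (v t)\<^sup>2 * (1 - v t)" by (simp add: cubic_def v)
      also have "\<dots> < 0" using v by (simp add: mult_pos_neg)
      finally show False using assms(2)[OF t(1)] by simp
    qed
    then show ?thesis by (intro Collect_cong) (meson less_imp_le)
  qed
  have c: "continuous_on {0..T} (\<lambda>t. k * v t)" by (intro continuous_intros assms)
  have "?A = {0..T} \<inter> v -` {1<..} \<inter> ({0..T} \<inter> (\<lambda>t. k * v t) -` {k + d<..})" by auto
  moreover have "openin (top_of_set {0..T}) \<dots>"
    by (intro openin_Int continuous_openin_preimage_gen assms c) auto
  ultimately have o: "openin (top_of_set {0..T}) ?A" by simp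
  have "?B = {0..T} \<inter> v -` {1..} \<inter> ({0..T} \<inter> (\<lambda>t. k * v t) -` {k + d..})" by auto
  moreover have "closedin (top_of_set {0..T}) \<dots>"
    by (intro closedin_Int continuous_closedin_preimage assms c) auto
  ultimately have "closedin (top_of_set {0..T}) ?B" by simp
  then have "closedin (top_of_set {0..T}) ?A" by (simp only: eq)
  moreover have "connected {0..T}" by simp
  ultimately have "?A = {} \<or> ?A = {0..T}" using o by (meson connected_clopen)
  moreover have "0 \<in> ?A" using assms by auto
  ultimately show ?thesis using assms(6) by blast
qed

section \<open>Chord addition on the cubic\<close>

text \<open>Addition on the cubic, with the point at infinity as neutral element: the line through the two
points has slope \<open>l\<close>, and \<open>w\<close> is the first coordinate of its third intersection with the curve, by the
formula for the sum of the roots of a cubic with leading coefficient \<open>-4\<close>; the result is the mirror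
image of this intersection in the \<open>v\<close>-axis.\<close>
definition chord :: "real \<Rightarrow> real \<times> real \<Rightarrow> real \<times> real \<Rightarrow> real \<times> real" where
  "chord k = (\<lambda>(v, Y) (s, e). let l = (Y - e) / (v - s); w = (k\<^sup>2 + 4 - l\<^sup>2) / 4 - v - s
      in (w, - (e + l * (w - s))))"

text \<open>Once the slope is guessed, the chord construction becomes a system of polynomial equations.\<close>
lemma chord_eqI:
  assumes "v \<noteq> s" "Y - e = l * (v - s)" "4 * (w + v + s) = k\<^sup>2 + 4 - l\<^sup>2" "- Z = e + l * (w - s)"
  shows "chord k (v, Y) (s, e) = (w, Z)"
proof -
  have l: "(Y - e) / (v - s) = l" using assms by (simp add: field_simps)
  have w: "(k\<^sup>2 + 4 - l\<^sup>2) / 4 - v - s = w" using assms(3) by (simp add: field_simps)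
  show ?thesis using assms(4) unfolding chord_def Let_def prod.case l w by simp
qed

text \<open>On a level curve \<open>step\<close> is the translation by \<open>P = (0, k + d)\<close>. The slope \<open>2 y - k\<close> of the chord
comes from \<open>2 y v = k v - (k + d) + Y\<close>.\<close>
lemma chord_step:
  assumes "0 < d" "p \<in> quadrant" "k = energy d p"
  shows "chord k (cubic_coords p) (0, k + d) = cubic_coords (step d p)"
proof -
  obtain x y where p: "p = (x, y)" "0 < x" "0 < y"
    using assms by (auto simp: quadrant_def)
  define w where "w = 1 / (x * y)"
  have w: "x * y * w = 1" using p by (simp add: w_def)
  obtain z where z: "step d p = (y, z)" "z = (y + d) * w" by (simp add: p step_def w_def)
  have k: "k = x + y + y * w + x * w + d * w" using p by (simp add: assms(3) energy_def w_def)
  have "chord k (x * y + 1, (y - x) * (x * y + 1)) (0, k + d) = (y * z + 1, (z - y) * (y * z + 1))"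
  proof (rule chord_eqI[where l = "2 * y - k"])
    show "x * y + 1 \<noteq> 0" using mult_pos_pos[OF p(2,3)] by linarith
  qed (use w in \<open>unfold k z(2), algebra+\<close>)
  then show ?thesis by (simp add: p z[unfolded p] cubic_coords_def)
qed

text \<open>The tangent at \<open>P = (0, k + d)\<close> meets the cubic again in \<open>(1, d)\<close>, so this point is \<open>- 2 P\<close>.\<close>
lemma chord_step_m2:
  assumes "0 < d" "p \<in> quadrant" "k = energy d p"
  shows "chord k (cubic_coords (step d (step d p))) (1, d) = cubic_coords p"
proof -
  obtain e c where p: "p = (e, c)" "0 < e" "0 < c"
    using assms by (auto simp: quadrant_def)
  obtain a where a: "step d (e, c) = (c, a)" "0 < a" "e * c * a = c + d"
    using step_pair p assms(1) by metis
  obtain b where b: "step d (c, a) = (a, b)" "0 < b" "c * a * b = a + d"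
    using step_pair p a assms(1) by metis
  define w where "w = 1 / (a * c)"
  have w: "a * c * w = 1" using p a by (simp add: w_def)
  have e: "e = (c + d) * w" using a(3) w by algebra
  have b': "b = (a + d) * w" using b(3) w by algebra
  have "energy d (c, a) = k" using energy_step[OF assms(1,2)] assms(3) p a by simp
  then have k: "k = a + c + e + a * w" using p a by (simp add: e energy_def w_def field_simps)
  have "chord k (a * b + 1, (b - a) * (a * b + 1)) (1, d) = (e * c + 1, (c - e) * (e * c + 1))"
  proof (rule chord_eqI[where l = "k - 2 * a - 2 * c"])
    show "a * b + 1 \<noteq> 1" using a b by simp
  qed (use w in \<open>unfold k e b', algebra+\<close>)
  then show ?thesis by (simp add: p a b cubic_coords_def)
qed

text \<open>The line through \<open>P = (0, k + d)\<close> and \<open>2 P = (1, - d)\<close> meets the cubic again in \<open>- 3 P\<close>, which is the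
point added here.\<close>
lemma chord_step_m3:
  assumes "0 < d" "p \<in> quadrant" "k = energy d p"
  shows "chord k (cubic_coords (step d (step d (step d p)))) (- d * (k + d), (k + d) * (1 + d\<^sup>2 + d * (k + d))) = cubic_coords p"
proof -
  obtain g e where p: "p = (g, e)" "0 < g" "0 < e"
    using assms by (auto simp: quadrant_def)
  obtain c where c: "step d (g, e) = (e, c)" "0 < c" "g * e * c = e + d"
    using step_pair p assms(1) by metis
  obtain a where a: "step d (e, c) = (c, a)" "0 < a" "e * c * a = c + d"
    using step_pair p c assms(1) by metis
  obtain b where b: "step d (c, a) = (a, b)" "0 < b" "c * a * b = a + d"
    using step_pair c a assms(1) by metis
  define w where "w = 1 / (a * c)"
  have w: "a * c * w = 1" using c a by (simp add: w_def)
  define u where "u = 1 / e"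
  have u: "e * u = 1" using p by (simp add: u_def)
  have e: "e = (c + d) * w" using a(3) w by algebra
  have b': "b = (a + d) * w" using b(3) w by algebra
  have g: "g = (e + d) * a * w * u" using c(3) w u by algebra
  have "energy d (c, a) = k" using energy_step[OF assms(1,2)] energy_step[of d "(e, c)"] assms(1,3) p a c
    by (simp add: quadrant_def)
  then have k: "k = a + c + e + a * w" using c a by (simp add: e energy_def w_def field_simps)
  have kp: "0 < k" unfolding assms(3) p energy_def using p assms(1) by (simp add: add_pos_pos)
  have "chord k (a * b + 1, (b - a) * (a * b + 1)) (- d * (k + d), (k + d) * (1 + d\<^sup>2 + d * (k + d))) = (g * e + 1, (e - g) * (g * e + 1))"
  proof (rule chord_eqI[where l = "a * w - a - c - e - 2 * d"])
    have "0 < a * b" "0 < d * (k + d)" using a b kp assms by simp_all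
    then show "a * b + 1 \<noteq> - d * (k + d)" by (simp add: algebra_simps)
    show "(b - a) * (a * b + 1) - (k + d) * (1 + d\<^sup>2 + d * (k + d)) = (a * w - a - c - e - 2 * d) * (a * b + 1 - - d * (k + d))"
      unfolding k b' using w e by algebra
    show "4 * (g * e + 1 + (a * b + 1) + - d * (k + d)) = k\<^sup>2 + 4 - (a * w - a - c - e - 2 * d)\<^sup>2"
      unfolding k b' using w e u g by algebra
    show "- ((e - g) * (g * e + 1)) = (k + d) * (1 + d\<^sup>2 + d * (k + d)) +
      (a * w - a - c - e - 2 * d) * (g * e + 1 - - d * (k + d))"
      unfolding k b' using w e u g by algebra
  qed
  then show ?thesis by (simp add: p a b c cubic_coords_def)
qed

text \<open>Translations preserve the invariant differential \<open>dv / Y\<close>. So if the second summand moves along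
the cubic with \<open>v' = Y\<close>, the sum moves in the same way. In coordinates this follows from one fact: the
slope \<open>l\<close> of the chord satisfies \<open>l' = 2 (w - s)\<close>, where \<open>w\<close> and \<open>s\<close> are the first coordinates of the sum
and of the moving summand.\<close>
lemma chord_solves:
  fixes s e :: "real \<Rightarrow> real"
  assumes ds: "(s has_real_derivative e t) (at t within S)"
    and de: "(e has_real_derivative half_slope d k (s t)) (at t within S)"
    and ne: "v \<noteq> s t" and Y: "Y\<^sup>2 = cubic d k v" and e: "(e t)\<^sup>2 = cubic d k (s t)"
  shows "((\<lambda>t. fst (chord k (v, Y) (s t, e t))) has_real_derivative snd (chord k (v, Y) (s t, e t))) (at t within S)" (is ?A)
    and "((\<lambda>t. snd (chord k (v, Y) (s t, e t))) has_real_derivative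
            half_slope d k (fst (chord k (v, Y) (s t, e t)))) (at t within S)" (is ?B)
    and "(snd (chord k (v, Y) (s t, e t)))\<^sup>2 = cubic d k (fst (chord k (v, Y) (s t, e t)))" (is ?C)
proof -
  define l where "l t = (Y - e t) / (v - s t)" for t
  define w where "w t = (k\<^sup>2 + 4 - (l t)\<^sup>2) / 4 - v - s t" for t
  have ch: "chord k (v, Y) (s t, e t) = (w t, - (e t + l t * (w t - s t)))" for t
    by (simp add: chord_def Let_def w_def l_def)
  have l: "l t * (v - s t) = Y - e t" using ne by (simp add: l_def)
  have w: "4 * w t = k\<^sup>2 + 4 - (l t)\<^sup>2 - 4 * v - 4 * s t" by (simp add: w_def field_simps)
  have "(v - s t) * (l t * (Y + e t)) =
    (v - s t) * ((k\<^sup>2 + 4) * (v + s t) - 2 * k * (k + d) - 4 * (v\<^sup>2 + v * s t + (s t)\<^sup>2))"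
    using l Y e unfolding cubic_def by algebra
  \<comment> \<open>Both sides are the difference quotient of the cubic along the chord.\<close>
  then have q: "l t * (Y + e t) = (k\<^sup>2 + 4) * (v + s t) - 2 * k * (k + d) - 4 * (v\<^sup>2 + v * s t + (s t)\<^sup>2)"
    using ne by simp
  have key: "- half_slope d k (s t) + l t * e t = 2 * (w t - s t) * (v - s t)"
    using q w l unfolding half_slope_def by algebra
  have dl: "(l has_real_derivative 2 * (w t - s t)) (at t within S)"
  proof -
    have "(l has_real_derivative ((- half_slope d k (s t)) * (v - s t) - (Y - e t) * (- e t)) / ((v - s t) * (v - s t))) (at t within S)"
      unfolding l_def by (rule derivative_eq_intros ds de refl | use ne in simp)+
    moreover have "(- half_slope d k (s t)) * (v - s t) - (Y - e t) * (- e t) = 2 * (w t - s t) * ((v - s t) * (v - s t))"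
      using key l by algebra
    ultimately show ?thesis using ne by simp
  qed
  have dw: "(w has_real_derivative - (e t + l t * (w t - s t))) (at t within S)"
    unfolding w_def[abs_def]
    by (rule derivative_eq_intros ds dl refl | simp)+ (simp add: w_def field_simps)
  show ?A using dw by (simp add: ch)
  have "((\<lambda>t. - (e t + l t * (w t - s t))) has_real_derivative
      - (half_slope d k (s t) + (2 * (w t - s t) * (w t - s t) + (- (e t + l t * (w t - s t)) - e t) * l t))) (at t within S)"
    by (rule derivative_eq_intros ds de dl dw refl)+
  moreover have "- (half_slope d k (s t) + (2 * (w t - s t) * (w t - s t) + (- (e t + l t * (w t - s t)) - e t) * l t)) = half_slope d k (w t)"
    using key q w l unfolding half_slope_def by algebra
  ultimately show ?B by (simp add: ch)
  have "(e t + l t * (w t - s t))\<^sup>2 = cubic d k (w t)"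
    using q w l e unfolding cubic_def by algebra
  then show ?C by (simp add: ch power2_eq_square algebra_simps)
qed

section \<open>The translation-invariant motion over one step\<close>

text \<open>In the coordinates \<open>ln x\<close>, \<open>ln y\<close> this is the Hamiltonian vector field of the energy; on every level
it corresponds to \<open>v' = Y\<close>.\<close>
definition velocity :: "real \<Rightarrow> real \<times> real \<Rightarrow> real \<times> real" where
  "velocity d = (\<lambda>(x, y). (x * y - (x + d) / y, (y + d) / x - x * y))"

lemma xy_coords_solves:
  assumes dv: "(v has_real_derivative Y t) (at t within S)"
    and dY: "(Y has_real_derivative half_slope d k (v t)) (at t within S)"
    and c: "(Y t)\<^sup>2 = cubic d k (v t)" "1 < v t" "k + d < k * v t" "0 < d"
  shows "((\<lambda>t. xy_coords d k (v t, Y t)) has_vector_derivative velocity d (xy_coords d k (v t, Y t))) (at t within S)"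
proof -
  obtain x y where u: "xy_coords d k (v t, Y t) = (x, y)" by fastforce
  have xy: "0 < x" "0 < y" and en: "k * x * y = x * y * (x + y) + x + y + d"
    and vY: "v t = x * y + 1" "Y t = (y - x) * (x * y + 1)"
    using oval_point_in_quadrant[OF c] by (auto simp: u quadrant_def energy_eq_iff cubic_coords_def)
  have v0: "v t \<noteq> 0" using c by simp
  have fx: "x * y - (x + d) / y = x\<^sup>2 + 2 * x * y + 1 - k * x"
    using xy en by (simp add: field_simps power2_eq_square)
  have fy: "(y + d) / x - x * y = - (y\<^sup>2 + 2 * x * y + 1 - k * y)"
    using xy en by (simp add: field_simps power2_eq_square)
  have 1: "((\<lambda>t. (k * v t - (k + d) - Y t) / (2 * v t)) has_real_derivative
      ((k * Y t - half_slope d k (v t)) * (2 * v t) - (k * v t - (k + d) - Y t) * (2 * Y t)) / ((2 * v t) * (2 * v t))) (at t within S)"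
    by (rule derivative_eq_intros dv dY refl | use v0 in simp)+
  have 2: "((\<lambda>t. (k * v t - (k + d) + Y t) / (2 * v t)) has_real_derivative
      ((k * Y t + half_slope d k (v t)) * (2 * v t) - (k * v t - (k + d) + Y t) * (2 * Y t)) / ((2 * v t) * (2 * v t))) (at t within S)"
    by (rule derivative_eq_intros dv dY refl | use v0 in simp)+
  have kv: "k * v t - (k + d) = (x + y) * v t" using en unfolding vY by algebra
  have "((k * Y t - half_slope d k (v t)) * (2 * v t) - (k * v t - (k + d) - Y t) * (2 * Y t))
      = (x\<^sup>2 + 2 * x * y + 1 - k * x) * ((2 * v t) * (2 * v t))"
    unfolding half_slope_def kv unfolding vY by algebra
  moreover have "((k * Y t + half_slope d k (v t)) * (2 * v t) - (k * v t - (k + d) + Y t) * (2 * Y t))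
      = - (y\<^sup>2 + 2 * x * y + 1 - k * y) * ((2 * v t) * (2 * v t))"
    unfolding half_slope_def kv unfolding vY by algebra
  moreover have fd: "velocity d (x, y) = (x\<^sup>2 + 2 * x * y + 1 - k * x, - (y\<^sup>2 + 2 * x * y + 1 - k * y))"
    unfolding velocity_def prod.case fx fy ..
  ultimately show ?thesis using 1 2 v0 unfolding u fd unfolding xy_coords_def prod.case
    by (intro has_vector_derivative_Pair) (simp_all add: has_real_derivative_iff_has_vector_derivative)
qed

text \<open>The inverse function of an integral of \<open>f\<close> solves \<open>g' = 1 / f (g)\<close>; it describes a motion with
prescribed speed \<open>1 / f\<close> as a function of time.\<close>
lemma inverse_of_integral:
  fixes f :: "real \<Rightarrow> real"
  assumes cont: "continuous_on {a..b} f" and pos: "\<And>v. v \<in> {a..b} \<Longrightarrow> 0 < f v" and ab: "a \<le> b"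
  obtains g where "\<And>c. c \<in> {a..b} \<Longrightarrow> g (integral {a..c} f) = c"
    and "\<And>t. t \<in> {0..integral {a..b} f} \<Longrightarrow> g t \<in> {a..b}"
    and "\<And>t. t \<in> {0..integral {a..b} f} \<Longrightarrow> (g has_real_derivative 1 / f (g t)) (at t)"
proof -
  \<comment> \<open>Extending \<open>f\<close> by constants makes \<open>a\<close> and \<open>b\<close> interior points, so that the inverse function
    theorem gives two-sided derivatives there too.\<close>
  define h where "h v = f (max a (min b v))" for v
  have hc: "continuous_on A h" for A
    unfolding h_def by (rule continuous_on_compose2[OF cont]) (use ab in \<open>auto intro!: continuous_intros\<close>)
  have hp: "0 < h v" for v unfolding h_def using ab by (intro pos) auto
  have hf: "h v = f v" if "v \<in> {a..b}" for v using that by (simp add: h_def)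
  define J where "J v = integral {a-1..v} h - integral {a-1..a} h" for v
  have dJ: "(J has_real_derivative h v) (at v)" if "v \<in> {a-1<..<b+1}" for v
  proof -
    have "(J has_real_derivative h v) (at v within {a-1..b+1})"
      unfolding J_def using integral_has_real_derivative[OF hc, of v "a-1" "b+1"] that
      by (auto intro!: derivative_eq_intros)
    moreover have "v \<in> interior {a-1..b+1}" using that by simp
    ultimately show ?thesis by (simp only: at_within_interior)
  qed
  have J: "J c = integral {a..c} f" if "c \<in> {a..b}" for c
  proof -
    have "integral {a-1..a} h + integral {a..c} h = integral {a-1..c} h"
      by (rule Henstock_Kurzweil_Integration.integral_combine) (use that integrable_continuous_real[OF hc] in auto)
    moreover have "integral {a..c} h = integral {a..c} f"
      by (rule integral_cong) (use that hf in auto)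
    ultimately show ?thesis by (simp add: J_def)
  qed
  let ?S = "{a-1<..<b+1}"
  have mono: "strict_mono_on ?S J"
  proof (rule strict_mono_onI)
    fix r s assume rs: "r \<in> ?S" "s \<in> ?S" "r < s"
    show "J r < J s"
    proof (rule DERIV_pos_imp_increasing[OF \<open>r < s\<close>])
      fix x assume "r \<le> x" "x \<le> s"
      then have "x \<in> ?S" using rs by auto
      then show "\<exists>y. (J has_real_derivative y) (at x) \<and> 0 < y" using dJ hp by blast
    qed
  qed
  then have inj: "inj_on J ?S" by (rule strict_mono_on_imp_inj_on)
  define g where "g = the_inv_into ?S J"
  have gJ: "g (J v) = v" if "v \<in> ?S" for v
    unfolding g_def using inj that by (rule the_inv_into_f_f)
  have contJ: "continuous_on ?S J"
    by (rule DERIV_continuous_on[of _ _ h]) (use dJ in \<open>auto intro: has_field_derivative_at_within\<close>)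
  have ex: "\<exists>v\<in>{a..b}. J v = t" if "t \<in> {0..integral {a..b} f}" for t
  proof -
    have "J a = 0" "J b = integral {a..b} f" using ab by (simp_all add: J)
    then have "\<exists>v\<ge>a. v \<le> b \<and> J v = t"
      using that ab by (intro IVT') (auto intro: continuous_on_subset[OF contJ])
    then show ?thesis by auto
  qed
  show ?thesis
  proof (rule that)
    show "g (integral {a..c} f) = c" if "c \<in> {a..b}" for c
      using gJ[of c] J[OF that] that by simp
    show "g t \<in> {a..b}" if t: "t \<in> {0..integral {a..b} f}" for t
      using ex[OF t] gJ by auto
    show "(g has_real_derivative 1 / f (g t)) (at t)" if t: "t \<in> {0..integral {a..b} f}" for t
    proof -
      obtain v where v: "v \<in> {a..b}" "J v = t" using ex[OF t] by auto
      have "(g has_real_derivative inverse (h v)) (at (J v))"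
        by (rule has_field_derivative_inverse_strong[where S = ?S])
           (use v dJ[of v] hp[of v] contJ gJ in auto)
      then show ?thesis using v gJ[of v] hf by (simp add: divide_inverse)
    qed
  qed
qed

text \<open>The time that a point \<open>(v, Y)\<close> with \<open>Y = sqrt (cubic d k v)\<close> and \<open>v' = Y\<close> needs to move from \<open>v = a\<close> to
\<open>v = b\<close>.\<close>
definition transit :: "real \<Rightarrow> real \<Rightarrow> real \<Rightarrow> real \<Rightarrow> real" where
  "transit d k a b = integral {a..b} (\<lambda>v. 1 / sqrt (cubic d k v))"

text \<open>The time from \<open>- 3 P\<close> to \<open>- 2 P\<close> in the notation above.\<close>
definition step_time :: "real \<Rightarrow> real \<Rightarrow> real" where
  "step_time d k = transit d k (- d * (k + d)) 1"

text \<open>The time from \<open>- 3 P\<close> to \<open>P\<close>.\<close>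
definition four_step_time :: "real \<Rightarrow> real \<Rightarrow> real" where
  "four_step_time d k = transit d k (- d * (k + d)) 0"

lemma continuous_on_cubic: "continuous_on S (cubic d k)"
  unfolding cubic_def[abs_def] by (intro continuous_intros)

lemma DERIV_sqrt_cubic:
  assumes "0 < cubic d k v"
  shows "((\<lambda>v. sqrt (cubic d k v)) has_real_derivative half_slope d k v / sqrt (cubic d k v)) (at v)"
proof -
  have "(cubic d k has_real_derivative 2 * half_slope d k v) (at v)"
    unfolding cubic_def[abs_def] half_slope_def
    by (rule derivative_eq_intros refl)+ (simp add: algebra_simps power2_eq_square)
  then have "((\<lambda>v. sqrt (cubic d k v)) has_real_derivative
      inverse (sqrt (cubic d k v)) / 2 * (2 * half_slope d k v)) (at v)"
    by (rule DERIV_chain2[where f = sqrt and g = "cubic d k", OF DERIV_real_sqrt[OF assms]])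
  then show ?thesis by (rule DERIV_cong) (simp add: inverse_eq_divide)
qed

lemma continuous_on_inverse_sqrt_cubic:
  assumes "0 < d" "0 < k" "b \<le> 1"
  shows "continuous_on {a..b} (\<lambda>v. 1 / sqrt (cubic d k v))"
proof (intro continuous_intros continuous_on_cubic ballI)
  fix v assume "v \<in> {a..b}"
  then have "0 < cubic d k v" using assms by (intro cubic_pos) auto
  then show "sqrt (cubic d k v) \<noteq> 0" by simp
qed

text \<open>Add the points \<open>(s, sqrt (cubic d k s))\<close> to the third iterate \<open>q\<close> of \<open>p\<close> while \<open>s\<close> runs from
\<open>- d (k + d)\<close> to \<open>1\<close>. The path starts at \<open>q - 3 P = p\<close>, passes at \<open>s = 0\<close> through \<open>q + P\<close>, the fourth
iterate of \<open>p\<close>, and ends at \<open>q - 2 P = step d p\<close>. Starting at \<open>q\<close> rather than \<open>p\<close> avoids the neutral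
element of the group, where the chord construction degenerates.\<close>
lemma trajectory_over_one_step:
  assumes d: "0 < d" and p: "p \<in> quadrant" and k: "k = energy d p"
  obtains \<gamma> where "\<gamma> 0 = p" "\<gamma> (four_step_time d k) = (step d ^^ 4) p" "\<gamma> (step_time d k) = step d p"
    "\<And>t. t \<in> {0..step_time d k} \<Longrightarrow> \<gamma> t \<in> quadrant \<and> energy d (\<gamma> t) = k \<and>
       (\<gamma> has_vector_derivative velocity d (\<gamma> t)) (at t within {0..step_time d k})"
proof -
  have k0: "0 < k" using energy_pos d p k by simp
  define a where "a = - d * (k + d)"
  have a0: "a < 0" using d k0 by (simp add: a_def)
  define T where "T = step_time d k"
  have T: "T = integral {a..1} (\<lambda>v. 1 / sqrt (cubic d k v))"
    by (simp add: T_def step_time_def transit_def a_def)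
  have pos: "0 < cubic d k v" if "v \<le> 1" for v using cubic_pos d k0 that by simp
  obtain s where s: "\<And>c. c \<in> {a..1} \<Longrightarrow> s (transit d k a c) = c"
    and sr: "\<And>t. t \<in> {0..T} \<Longrightarrow> s t \<in> {a..1}"
    and ds: "\<And>t. t \<in> {0..T} \<Longrightarrow> (s has_real_derivative 1 / (1 / sqrt (cubic d k (s t)))) (at t)"
    unfolding T transit_def
  proof (rule inverse_of_integral[OF continuous_on_inverse_sqrt_cubic[OF d k0 order_refl]])
    show "0 < 1 / sqrt (cubic d k v)" if "v \<in> {a..1}" for v using pos that by simp
    show "a \<le> 1" using a0 by simp
  qed blast
  define e where "e t = sqrt (cubic d k (s t))" for t
  have ds': "(s has_real_derivative e t) (at t within {0..T})" if "t \<in> {0..T}" for t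
    using ds[OF that] by (simp add: e_def has_field_derivative_at_within)
  have de: "(e has_real_derivative half_slope d k (s t)) (at t within {0..T})" if "t \<in> {0..T}" for t
  proof -
    have "0 < cubic d k (s t)" using sr[OF that] pos by auto
    then show ?thesis
      using DERIV_chain2[where f = "\<lambda>v. sqrt (cubic d k v)" and g = s, OF DERIV_sqrt_cubic ds'[OF that]]
      unfolding e_def[abs_def] by simp
  qed
  define q where "q = step d (step d (step d p))"
  have q: "q \<in> quadrant" "energy d q = k"
    using d p k by (simp_all add: q_def step_quadrant energy_step)
  obtain v Y where w: "cubic_coords q = (v, Y)" by fastforce
  note vY = cubic_coords_on_oval[OF d q(1) w q(2)[symmetric]]
  define W where "W t = chord k (v, Y) (s t, e t)" for t
  have ne: "v \<noteq> s t" if "t \<in> {0..T}" for t using sr[OF that] vY by auto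
  have e2: "(e t)\<^sup>2 = cubic d k (s t)" if "t \<in> {0..T}" for t
    using sr[OF that] pos[of "s t"] by (simp add: e_def)
  note W = chord_solves[OF ds' de ne vY(1) e2, folded W_def]
  have W0: "W 0 = cubic_coords p"
  proof -
    have "s 0 = a" using s[of a] a0 by (simp add: transit_def)
    moreover have "e 0 = (k + d) * (1 + d\<^sup>2 + d * (k + d))"
    proof -
      have "cubic d k a = ((k + d) * (1 + d\<^sup>2 + d * (k + d)))\<^sup>2"
        unfolding cubic_def a_def by algebra
      then show ?thesis using d k0 by (simp add: e_def \<open>s 0 = a\<close>)
    qed
    ultimately show ?thesis using chord_step_m3[OF d p k] by (simp add: W_def a_def flip: w q_def)
  qed
  obtain v0 Y0 where w0: "cubic_coords p = (v0, Y0)" by fastforce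
  have oval: "1 < fst (W t) \<and> k + d < k * fst (W t)" if "t \<in> {0..T}" for t
  proof (rule oval_persists[OF _ _ _ _ d that])
    show "continuous_on {0..T} (\<lambda>t. fst (W t))"
      by (rule DERIV_continuous_on) (rule W(1))
    show "0 \<le> cubic d k (fst (W t))" if "t \<in> {0..T}" for t
      using W(3)[OF that that that that] by (metis zero_le_power2)
  qed (use cubic_coords_on_oval[OF d p w0 k] W0 w0 in auto)
  define \<gamma> where "\<gamma> t = xy_coords d k (W t)" for t
  have xy_coords: "xy_coords d k (cubic_coords p') = p'" if "p' \<in> quadrant" "energy d p' = k" for p'
    using cubic_coords_on_oval(4)[OF d that(1) _ that(2)[symmetric]]
    by (cases "cubic_coords p'") (simp add: xy_coords_def)
  show ?thesis
  proof (rule that)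
    show "\<gamma> 0 = p" using xy_coords p k by (simp add: \<gamma>_def W0)
    have "s (four_step_time d k) = 0" using s[of 0] a0 by (simp add: four_step_time_def a_def)
    moreover have "sqrt (cubic d k 0) = k + d" using d k0 by (simp add: cubic_def)
    ultimately have "W (four_step_time d k) = chord k (cubic_coords q) (0, k + d)"
      by (simp add: W_def e_def w)
    also have "\<dots> = cubic_coords (step d q)" using chord_step[OF d q(1) q(2)[symmetric]] .
    finally show "\<gamma> (four_step_time d k) = (step d ^^ 4) p"
      using xy_coords[of "step d q"] q d
      by (simp add: \<gamma>_def step_quadrant energy_step q_def eval_nat_numeral)
    have p1: "step d p \<in> quadrant" "k = energy d (step d p)" using d p k by (simp_all add: step_quadrant energy_step)
    have "s T = 1" using s[of 1] a0 by (simp add: T transit_def)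
    then have "W T = chord k (cubic_coords q) (1, d)" using d by (simp add: W_def e_def w cubic_def)
    also have "\<dots> = cubic_coords (step d p)" using chord_step_m2[OF d p1] by (simp add: q_def)
    finally show "\<gamma> (step_time d k) = step d p"
      using xy_coords[OF p1(1) p1(2)[symmetric]] by (simp add: \<gamma>_def flip: T_def)
    show "\<gamma> t \<in> quadrant \<and> energy d (\<gamma> t) = k \<and>
       (\<gamma> has_vector_derivative velocity d (\<gamma> t)) (at t within {0..step_time d k})"
      if t: "t \<in> {0..step_time d k}" for t
    proof -
      have t': "t \<in> {0..T}" using t by (simp add: T_def)
      note Wt = W[OF t' t' t' t'] oval[OF t']
      have "\<gamma> t \<in> quadrant" "energy d (\<gamma> t) = k"
        using oval_point_in_quadrant[of "snd (W t)" d k "fst (W t)"] Wt(3,4) d by (simp_all add: \<gamma>_def)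
      moreover have "(\<gamma> has_vector_derivative velocity d (\<gamma> t)) (at t within {0..T})"
        using xy_coords_solves[OF Wt(1,2,3) _ _ d] Wt(4) by (simp add: \<gamma>_def[abs_def])
      ultimately show ?thesis by (simp add: T_def)
    qed
  qed
qed

lemma transit_pos:
  assumes "0 < d" "0 < k" "a < b" "b \<le> 1"
  shows "0 < transit d k a b"
proof -
  let ?f = "\<lambda>v. 1 / sqrt (cubic d k v)"
  have c: "continuous_on {a..b} ?f" using assms by (intro continuous_on_inverse_sqrt_cubic)
  have pos: "0 < ?f v" if "v \<in> {a..b}" for v using cubic_pos[of d k v] assms that by simp
  obtain v where v: "v \<in> {a..b}" "\<And>w. w \<in> {a..b} \<Longrightarrow> ?f v \<le> ?f w"
    using continuous_attains_inf[OF compact_Icc _ c] assms by auto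
  have "0 < (b - a) * ?f v" using pos[OF v(1)] assms by simp
  also have "\<dots> = integral {a..b} (\<lambda>_. ?f v)" using assms by simp
  also have "\<dots> \<le> integral {a..b} ?f"
    by (rule integral_le) (use v integrable_continuous_real[OF c] in auto)
  finally show ?thesis by (simp add: transit_def)
qed

lemma transit_combine:
  assumes "0 < d" "0 < k" "a \<le> b" "b \<le> c" "c \<le> 1"
  shows "transit d k a b + transit d k b c = transit d k a c"
  unfolding transit_def
  by (rule Henstock_Kurzweil_Integration.integral_combine)
     (use assms in \<open>auto intro!: integrable_continuous_real continuous_on_inverse_sqrt_cubic\<close>)

lemma four_step_time_bounds:
  assumes "0 < d" "0 < k"
  shows "0 < four_step_time d k" "four_step_time d k < step_time d k"
proof -
  have a: "- d * (k + d) < 0" using assms by simp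
  show "0 < four_step_time d k" unfolding four_step_time_def by (rule transit_pos) (use assms a in auto)
  have "0 < transit d k 0 1" by (rule transit_pos) (use assms in auto)
  then show "four_step_time d k < step_time d k"
    using transit_combine[of d k "- d * (k + d)" 0 1] a assms
    by (simp add: four_step_time_def step_time_def)
qed

section \<open>The global forward flow\<close>

definition trajectory :: "real \<Rightarrow> real \<times> real \<Rightarrow> real \<Rightarrow> real \<times> real" where
  "trajectory d p = (SOME \<gamma>. \<gamma> 0 = p \<and> \<gamma> (four_step_time d (energy d p)) = (step d ^^ 4) p \<and>
     \<gamma> (step_time d (energy d p)) = step d p \<and>
     (\<forall>t\<in>{0..step_time d (energy d p)}. \<gamma> t \<in> quadrant \<and> energy d (\<gamma> t) = energy d p \<and>
       (\<gamma> has_vector_derivative velocity d (\<gamma> t)) (at t within {0..step_time d (energy d p)})))"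

lemma trajectory:
  assumes "0 < d" "p \<in> quadrant"
  shows "trajectory d p 0 = p" "trajectory d p (four_step_time d (energy d p)) = (step d ^^ 4) p"
    "trajectory d p (step_time d (energy d p)) = step d p"
    "t \<in> {0..step_time d (energy d p)} \<Longrightarrow> trajectory d p t \<in> quadrant"
    "t \<in> {0..step_time d (energy d p)} \<Longrightarrow> energy d (trajectory d p t) = energy d p"
    "t \<in> {0..step_time d (energy d p)} \<Longrightarrow>
       (trajectory d p has_vector_derivative velocity d (trajectory d p t)) (at t within {0..step_time d (energy d p)})"
proof -
  have "\<exists>\<gamma>. \<gamma> 0 = p \<and> \<gamma> (four_step_time d (energy d p)) = (step d ^^ 4) p \<and>
     \<gamma> (step_time d (energy d p)) = step d p \<and>
     (\<forall>t\<in>{0..step_time d (energy d p)}. \<gamma> t \<in> quadrant \<and> energy d (\<gamma> t) = energy d p \<and>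
       (\<gamma> has_vector_derivative velocity d (\<gamma> t)) (at t within {0..step_time d (energy d p)}))"
    by (rule trajectory_over_one_step[OF assms refl]) blast
  from someI_ex[OF this, folded trajectory_def]
  show "trajectory d p 0 = p" "trajectory d p (four_step_time d (energy d p)) = (step d ^^ 4) p"
    "trajectory d p (step_time d (energy d p)) = step d p"
    "t \<in> {0..step_time d (energy d p)} \<Longrightarrow> trajectory d p t \<in> quadrant"
    "t \<in> {0..step_time d (energy d p)} \<Longrightarrow> energy d (trajectory d p t) = energy d p"
    "t \<in> {0..step_time d (energy d p)} \<Longrightarrow>
       (trajectory d p has_vector_derivative velocity d (trajectory d p t)) (at t within {0..step_time d (energy d p)})"
    by blast+
qed

text \<open>The trajectories over one step are joined: each one ends where the trajectory of the next iterate
begins.\<close>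
definition flow :: "real \<Rightarrow> real \<times> real \<Rightarrow> real \<Rightarrow> real \<times> real" where
  "flow d p t = (let T = step_time d (energy d p); m = nat \<lfloor>t / T\<rfloor>
     in trajectory d ((step d ^^ m) p) (t - m * T))"

lemma step_iterate:
  assumes "0 < d" "p \<in> quadrant"
  shows "(step d ^^ n) p \<in> quadrant" "energy d ((step d ^^ n) p) = energy d p"
  using assms by (induction n) (auto simp: step_quadrant energy_step)

lemma has_vector_derivative_Un:
  assumes "(f has_vector_derivative f') (at x within S)" "(f has_vector_derivative f') (at x within S')"
  shows "(f has_vector_derivative f') (at x within S \<union> S')"
  using assms unfolding has_vector_derivative_def has_derivative_within by (auto intro: Lim_Un)

text \<open>At an end point that two consecutive intervals share, the two one-sided derivatives agree, so
they combine into a derivative.\<close>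
lemma has_vector_derivative_glue:
  fixes T :: real
  assumes T: "0 < T" and t: "0 \<le> t"
    and f: "\<And>m::nat. t \<in> {real m * T..(real m + 1) * T} \<Longrightarrow> (f has_vector_derivative f') (at t within {real m * T..(real m + 1) * T})"
  shows "(f has_vector_derivative f') (at t within {0..})"
proof -
  define m where "m = nat \<lfloor>t / T\<rfloor>"
  have "real m = of_int \<lfloor>t / T\<rfloor>" using T t by (simp add: m_def)
  then have "real m \<le> t / T" "t / T < real m + 1" by linarith+
  then have m: "real m * T \<le> t" "t < (real m + 1) * T" using T by (simp_all add: field_simps)
  then have "t \<in> {real m * T..(real m + 1) * T}" by simp
  then have fm: "(f has_vector_derivative f') (at t within {real m * T..(real m + 1) * T})" by (rule f)
  consider "m * T < t" | "t = m * T" "0 < m" | "t = 0" "m = 0" using m T by fastforce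
  then show ?thesis
  proof cases
    case 1
    then have "t \<in> interior {real m * T..(real m + 1) * T}" using m by simp
    then show ?thesis using fm by (metis at_within_interior has_vector_derivative_at_within)
  next
    case 2
    then obtain j where j: "m = Suc j" by (metis gr0_implies_Suc)
    have "(f has_vector_derivative f') (at t within {real j * T..(real j + 1) * T})"
      by (rule f) (use 2 j T in \<open>auto simp: algebra_simps\<close>)
    then have "(f has_vector_derivative f') (at t within {real j * T..(real j + 1) * T} \<union> {real m * T..(real m + 1) * T})"
      using fm by (rule has_vector_derivative_Un)
    moreover have "{real j * T..(real j + 1) * T} \<union> {real m * T..(real m + 1) * T} = {real j * T..(real m + 1) * T}"
      using j T by (auto simp: algebra_simps)
    moreover have "t \<in> interior {real j * T..(real m + 1) * T}" using 2 j T by (simp add: algebra_simps)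
    ultimately show ?thesis by (metis at_within_interior has_vector_derivative_at_within)
  next
    case 3
    have "at t within {0..} = at t within {real m * T..(real m + 1) * T}"
      by (rule at_within_nhd[of _ "{..<T}"]) (use 3 T in auto)
    then show ?thesis using fm by simp
  qed
qed

context
  fixes d :: real and p :: "real \<times> real"
  assumes d: "0 < d" and p: "p \<in> quadrant"
begin

lemma step_time_pos: "0 < step_time d (energy d p)"
  using four_step_time_bounds[OF d energy_pos[OF d p]] by simp

lemma flow_on_piece:
  assumes t: "t \<in> {real m * step_time d (energy d p)..(real m + 1) * step_time d (energy d p)}"
  shows "flow d p t = trajectory d ((step d ^^ m) p) (t - m * step_time d (energy d p))"
proof -
  define T where "T = step_time d (energy d p)"
  have T: "0 < T" unfolding T_def by (rule step_time_pos)
  have "m \<le> t / T" "t / T \<le> m + 1" using t T by (simp_all add: field_simps flip: T_def)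
  then consider "\<lfloor>t / T\<rfloor> = int m" | "t / T = m + 1" by linarith
  then show ?thesis
  proof cases
    case 1
    then show ?thesis by (simp add: flow_def Let_def flip: T_def)
  next
    case 2
    then have t': "t = (m + 1) * T" using T by (simp add: field_simps)
    have "nat \<lfloor>t / T\<rfloor> = m + 1" unfolding 2 by simp
    then have "flow d p t = trajectory d ((step d ^^ (m + 1)) p) (t - (m + 1) * T)"
      by (simp add: flow_def Let_def flip: T_def)
    also have "\<dots> = (step d ^^ (m + 1)) p" using trajectory(1)[OF d step_iterate(1)[OF d p], of "Suc m"] t' by simp
    also have "\<dots> = trajectory d ((step d ^^ m) p) (t - m * T)"
      using trajectory(3)[OF d step_iterate(1)[OF d p], of m] t'
      by (simp add: step_iterate[OF d p] algebra_simps flip: T_def)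
    finally show ?thesis by (simp add: T_def)
  qed
qed

lemma obtain_piece:
  assumes "0 \<le> t"
  obtains m :: nat where "t \<in> {real m * step_time d (energy d p)..(real m + 1) * step_time d (energy d p)}"
proof (rule that[of "nat \<lfloor>t / step_time d (energy d p)\<rfloor>"])
  define T where "T = step_time d (energy d p)"
  have T: "0 < T" unfolding T_def by (rule step_time_pos)
  define m where "m = nat \<lfloor>t / T\<rfloor>"
  have "real m = of_int \<lfloor>t / T\<rfloor>" using T assms by (simp add: m_def)
  then have "real m \<le> t / T" "t / T < real m + 1" by linarith+
  then have "real m * T \<le> t" "t < (real m + 1) * T" using T by (simp_all add: field_simps)
  then show "t \<in> {real (nat \<lfloor>t / step_time d (energy d p)\<rfloor>) * step_time d (energy d p)..
         (real (nat \<lfloor>t / step_time d (energy d p)\<rfloor>) + 1) * step_time d (energy d p)}"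
    by (simp flip: T_def m_def)
qed

lemma flow_invariants:
  assumes "0 \<le> t"
  shows "flow d p t \<in> quadrant" "energy d (flow d p t) = energy d p"
proof -
  obtain m :: nat where m: "t \<in> {real m * step_time d (energy d p)..(real m + 1) * step_time d (energy d p)}"
    using obtain_piece[OF assms] .
  then have "t - m * step_time d (energy d p) \<in> {0..step_time d (energy d ((step d ^^ m) p))}"
    by (simp add: step_iterate[OF d p] algebra_simps)
  then show "flow d p t \<in> quadrant" "energy d (flow d p t) = energy d p"
    using trajectory(4,5)[OF d step_iterate(1)[OF d p]] flow_on_piece[OF m]
    by (simp_all add: step_iterate[OF d p])
qed

lemma flow_solves:
  assumes "0 \<le> t"
  shows "(flow d p has_vector_derivative velocity d (flow d p t)) (at t within {0..})"
proof (rule has_vector_derivative_glue[OF step_time_pos assms])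
  fix m :: nat
  define T where "T = step_time d (energy d p)"
  define q where "q = (step d ^^ m) p"
  have q: "q \<in> quadrant" "energy d q = energy d p" by (simp_all add: q_def step_iterate[OF d p])
  assume "t \<in> {real m * step_time d (energy d p)..(real m + 1) * step_time d (energy d p)}"
  then have t: "t \<in> {real m * T..(real m + 1) * T}" by (simp add: T_def)
  have eq: "flow d p s = trajectory d q (s - m * T)" if "s \<in> {real m * T..(real m + 1) * T}" for s
    using flow_on_piece[of s m] that by (simp add: T_def q_def)
  have sh: "(\<lambda>s. s - m * T) ` {real m * T..(real m + 1) * T} = {0..T}"
    by (simp add: image_diff_atLeastAtMost algebra_simps)
  have "(trajectory d q has_vector_derivative velocity d (trajectory d q (t - m * T)))
      (at (t - m * T) within (\<lambda>s. s - m * T) ` {real m * T..(real m + 1) * T})"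
    unfolding sh using trajectory(6)[OF d q(1), of "t - m * T"] t by (simp add: q(2) T_def algebra_simps)
  moreover have "((\<lambda>s. s - m * T) has_real_derivative 1) (at t within {real m * T..(real m + 1) * T})"
    by (auto intro!: derivative_eq_intros)
  ultimately have "(trajectory d q \<circ> (\<lambda>s. s - m * T) has_vector_derivative 1 *\<^sub>R velocity d (trajectory d q (t - m * T)))
      (at t within {real m * T..(real m + 1) * T})"
    by (intro vector_diff_chain_within) (simp_all add: has_real_derivative_iff_has_vector_derivative)
  then have "(flow d p has_vector_derivative velocity d (trajectory d q (t - m * T)))
      (at t within {real m * T..(real m + 1) * T})"
    by (intro has_vector_derivative_transform[OF t, of "flow d p"]) (use eq in \<open>simp_all add: o_def\<close>)
  then show "(flow d p has_vector_derivative velocity d (flow d p t))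
      (at t within {real m * step_time d (energy d p)..(real m + 1) * step_time d (energy d p)})"
    using eq[OF t] by (simp add: T_def)
qed

lemma flow_step: "flow d p (real n * step_time d (energy d p)) = (step d ^^ n) p"
  using flow_on_piece[of "real n * step_time d (energy d p)" n] trajectory(1)[OF d step_iterate(1)[OF d p]]
    step_time_pos by (simp add: algebra_simps)

lemma flow_0: "flow d p 0 = p" using flow_step[of 0] by simp

lemma flow_four_step: "flow d p (four_step_time d (energy d p)) = (step d ^^ 4) p"
  using flow_on_piece[of "four_step_time d (energy d p)" 0] trajectory(2)[OF d p]
    four_step_time_bounds[OF d energy_pos[OF d p]] by simp

end

section \<open>Continuous dependence on the initial point\<close>

definition square :: "real \<Rightarrow> (real \<times> real) set" where
  "square K = {1 / K..K} \<times> {1 / K..K}"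

text \<open>The energy bounds each of its summands \<open>x\<close>, \<open>y\<close>, \<open>1 / x\<close>, \<open>1 / y\<close>.\<close>
lemma sublevel_subset_square:
  assumes "0 < d" "p \<in> quadrant" "energy d p \<le> K"
  shows "p \<in> square K"
proof -
  obtain x y where p: "p = (x, y)" "0 < x" "0 < y"
    using assms by (auto simp: quadrant_def)
  have "0 < x" "0 < y" "0 < 1 / x" "0 < 1 / y" "0 < d / (x * y)" using p assms by auto
  then have le: "x \<le> K" "y \<le> K" "1 / x \<le> K" "1 / y \<le> K"
    using assms(3) unfolding p energy_def prod.case by linarith+
  then have "0 < K" using p by linarith
  with le show ?thesis using p by (simp add: square_def field_simps)
qed

lemma velocity_lipschitz_on_square:
  assumes "0 < d" "1 \<le> K"
  obtains C where "0 \<le> C" "\<And>p q. p \<in> square K \<Longrightarrow> q \<in> square K \<Longrightarrow> norm (velocity d p - velocity d q) \<le> C * norm (p - q)"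
proof
  define C where "C = 2 * (2 * K + 2 * K ^ 3 + d * K\<^sup>2)"
  show "0 \<le> C" using assms by (simp add: C_def)
  fix p q assume pq: "p \<in> square K" "q \<in> square K"
  obtain x y where p: "p = (x, y)" by fastforce
  obtain x' y' where q: "q = (x', y')" by fastforce
  have inv: "0 < z \<and> 1 / z \<le> K" if "1 / K \<le> z" for z
  proof -
    have "0 < 1 / K" using assms by simp
    then have "0 < z" using that by linarith
    then show ?thesis using that assms by (simp add: field_simps)
  qed
  then have b: "0 < x" "x \<le> K" "0 < y" "y \<le> K" "0 < x'" "x' \<le> K" "0 < y'" "y' \<le> K"
    and i: "1 / x \<le> K" "1 / y \<le> K" "1 / x' \<le> K" "1 / y' \<le> K"
    using pq inv unfolding p q square_def by auto
  define n where "n = norm (p - q)"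
  have dx: "\<bar>x - x'\<bar> \<le> n" and dy: "\<bar>y - y'\<bar> \<le> n"
    using norm_fst_le[of "x - x'" "y - y'"] norm_snd_le[of "y - y'" "x - x'"] by (simp_all add: p q n_def)
  have n0: "0 \<le> n" by (simp add: n_def)
  have prod: "\<bar>x * y - x' * y'\<bar> \<le> 2 * K * n"
  proof -
    have "x * y - x' * y' = x * (y - y') + (x - x') * y'" by (simp add: algebra_simps)
    then have "\<bar>x * y - x' * y'\<bar> \<le> \<bar>x * (y - y')\<bar> + \<bar>(x - x') * y'\<bar>"
      by (metis abs_triangle_ineq)
    then have "\<bar>x * y - x' * y'\<bar> \<le> x * \<bar>y - y'\<bar> + \<bar>x - x'\<bar> * y'"
      using b by (simp add: abs_mult)
    also have "\<dots> \<le> K * n + n * K"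
      by (intro add_mono mult_mono) (use b dx dy n0 in auto)
    finally show ?thesis by simp
  qed
  have quot: "\<bar>(u + d) / v - (u' + d) / v'\<bar> \<le> (2 * K ^ 3 + d * K\<^sup>2) * n"
    if u: "0 < u" "u \<le> K" "0 < v" "v \<le> K" "0 < u'" "u' \<le> K" "0 < v'" "v' \<le> K"
      and i: "1 / v \<le> K" "1 / v' \<le> K" and du: "\<bar>u - u'\<bar> \<le> n" and dv: "\<bar>v - v'\<bar> \<le> n" for u v u' v'
  proof -
    have "(u + d) / v - (u' + d) / v' = (v' * (u - u') + (u' + d) * (v' - v)) * ((1 / v) * (1 / v'))"
      using u by (simp add: field_simps)
    then have "\<bar>(u + d) / v - (u' + d) / v'\<bar> = \<bar>v' * (u - u') + (u' + d) * (v' - v)\<bar> * ((1 / v) * (1 / v'))"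
      using u by (simp add: abs_mult)
    also have "\<dots> \<le> (K * n + (K + d) * n) * (K * K)"
    proof (intro mult_mono)
      have "\<bar>v' * (u - u') + (u' + d) * (v' - v)\<bar> \<le> v' * \<bar>u - u'\<bar> + (u' + d) * \<bar>v' - v\<bar>"
        using abs_triangle_ineq[of "v' * (u - u')" "(u' + d) * (v' - v)"] u assms
        by (simp add: abs_mult)
      also have "\<dots> \<le> K * n + (K + d) * n"
        by (intro add_mono mult_mono) (use u du dv n0 assms in auto)
      finally show "\<bar>v' * (u - u') + (u' + d) * (v' - v)\<bar> \<le> K * n + (K + d) * n" .
    qed (use u i n0 assms in auto)
    also have "\<dots> = (2 * K ^ 3 + d * K\<^sup>2) * n" by (simp add: algebra_simps power2_eq_square power3_eq_cube)
    finally show ?thesis .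
  qed
  have "norm (velocity d p - velocity d q) \<le> \<bar>(x * y - (x + d) / y) - (x' * y' - (x' + d) / y')\<bar>
      + \<bar>((y + d) / x - x * y) - ((y' + d) / x' - x' * y')\<bar>"
    unfolding p q velocity_def prod.case using norm_Pair_le by (metis diff_Pair real_norm_def)
  also have "\<dots> \<le> C * n"
    using prod quot[OF b i(2,4) dx dy] quot[OF b(3,4,1,2) b(7,8,5,6) i(1,3) dy dx]
    by (simp add: C_def algebra_simps)
  finally show "norm (velocity d p - velocity d q) \<le> C * norm (p - q)" by (simp add: n_def)
qed

text \<open>The function \<open>exp (- 2 C t) (norm (f t - g t))\<^sup>2\<close> has a nonpositive derivative.\<close>
lemma gronwall:
  fixes f g :: "real \<Rightarrow> 'a::real_inner"
  assumes f: "\<And>t. t \<in> {0..T} \<Longrightarrow> (f has_vector_derivative X (f t)) (at t within {0..T})"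
    and g: "\<And>t. t \<in> {0..T} \<Longrightarrow> (g has_vector_derivative X (g t)) (at t within {0..T})"
    and C: "\<And>t. t \<in> {0..T} \<Longrightarrow> norm (X (f t) - X (g t)) \<le> C * norm (f t - g t)" and T: "0 \<le> T"
  shows "norm (f T - g T) \<le> exp (C * T) * norm (f 0 - g 0)"
proof -
  define u where "u t = f t - g t" for t
  define u' where "u' t = X (f t) - X (g t)" for t
  define D where "D t = exp (- 2 * C * t) * (u t \<bullet> u t)" for t
  define D' where "D' t = exp (- 2 * C * t) * (2 * (u t \<bullet> u' t) - 2 * C * (u t \<bullet> u t))" for t
  have dD: "(D has_real_derivative D' t) (at t within {0..T})" if t: "t \<in> {0..T}" for t
  proof -
    have "(u has_vector_derivative u' t) (at t within {0..T})"
      unfolding u_def u'_def by (intro has_vector_derivative_diff f g t)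
    from bounded_bilinear.has_vector_derivative[OF bounded_bilinear_inner this this]
    have "((\<lambda>t. u t \<bullet> u t) has_real_derivative u t \<bullet> u' t + u' t \<bullet> u t) (at t within {0..T})"
      by (simp add: has_real_derivative_iff_has_vector_derivative)
    then show ?thesis unfolding D_def[abs_def] D'_def
      by (auto intro!: derivative_eq_intros simp: inner_commute algebra_simps)
  qed
  have neg: "D' t \<le> 0" if "t \<in> {0..T}" for t
  proof -
    have "u t \<bullet> u' t \<le> norm (u t) * norm (u' t)" by (rule norm_cauchy_schwarz)
    also have "\<dots> \<le> norm (u t) * (C * norm (u t))"
      by (intro mult_left_mono) (use C[OF that] in \<open>auto simp: u_def u'_def\<close>)
    also have "\<dots> = C * (u t \<bullet> u t)" by (simp add: dot_square_norm power2_eq_square)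
    finally show ?thesis by (simp add: D'_def mult_nonneg_nonpos)
  qed
  have "D T \<le> D 0"
  proof (cases "T = 0")
    case False
    then have "0 < T" using T by simp
    then obtain z where "z \<in> {0..T}" "D T - D 0 = D' z * (T - 0)"
      using mvt_very_simple[of 0 T D "\<lambda>t. (*) (D' t)"] dD by (auto simp: has_field_derivative_def)
    then show ?thesis using mult_nonpos_nonneg[OF neg T, of z] by simp
  qed simp
  then have "(norm (u T))\<^sup>2 \<le> (exp (C * T) * norm (u 0))\<^sup>2"
    by (simp add: D_def dot_square_norm exp_minus field_simps power_mult_distrib flip: exp_double)
  then show ?thesis unfolding u_def by (rule power2_le_imp_le) simp
qed

definition square_solution :: "real \<Rightarrow> real \<Rightarrow> real \<Rightarrow> (real \<Rightarrow> real \<times> real) \<Rightarrow> bool" where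
  "square_solution d K T f \<longleftrightarrow>
    (\<forall>t\<in>{0..T}. f t \<in> square K \<and> (f has_vector_derivative velocity d (f t)) (at t within {0..T}))"

lemma square_solutions_diverge_exponentially:
  assumes d: "0 < d" and K: "1 \<le> K"
  obtains C where "0 \<le> C"
    "\<And>T f g. \<lbrakk>0 \<le> T; square_solution d K T f; square_solution d K T g\<rbrakk> \<Longrightarrow>
       norm (f T - g T) \<le> exp (C * T) * norm (f 0 - g 0)"
proof -
  obtain C where C: "0 \<le> C"
    "\<And>p q. p \<in> square K \<Longrightarrow> q \<in> square K \<Longrightarrow> norm (velocity d p - velocity d q) \<le> C * norm (p - q)"
    using velocity_lipschitz_on_square[OF d K] by blast
  show ?thesis
  proof (rule that[OF C(1)])
    fix T f g assume "0 \<le> T" "square_solution d K T f" "square_solution d K T g"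
    then show "norm (f T - g T) \<le> exp (C * T) * norm (f 0 - g 0)"
      by (intro gronwall[where X = "velocity d"] C(2)) (auto simp: square_solution_def)
  qed
qed

lemma flow_square_solution:
  assumes d: "0 < d" and p: "p \<in> quadrant" "energy d p \<le> K"
  shows "square_solution d K T (flow d p)"
  unfolding square_solution_def
proof (intro ballI conjI)
  fix t assume t: "t \<in> {0..T}"
  then show "flow d p t \<in> square K"
    using sublevel_subset_square[OF d] flow_invariants[OF d p(1), of t] p(2) by auto
  show "(flow d p has_vector_derivative velocity d (flow d p t)) (at t within {0..T})"
    by (rule has_vector_derivative_within_subset[OF flow_solves[OF d p(1)]]) (use t in auto)
qed

text \<open>Uniqueness of solutions: as functions of \<open>t\<close> both sides solve the same differential equation with the
same value at \<open>0\<close>, and solutions in a common square diverge at most exponentially.\<close>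
lemma flow_add:
  assumes d: "0 < d" and p: "p \<in> quadrant" and s: "0 \<le> s" and t: "0 \<le> t"
  shows "flow d (flow d p s) t = flow d p (s + t)"
proof -
  define K where "K = max 1 (energy d p)"
  have K: "1 \<le> K" "energy d p \<le> K" by (simp_all add: K_def)
  obtain C where C: "\<And>T f g. \<lbrakk>0 \<le> T; square_solution d K T f; square_solution d K T g\<rbrakk> \<Longrightarrow>
       norm (f T - g T) \<le> exp (C * T) * norm (f 0 - g 0)"
    using square_solutions_diverge_exponentially[OF d K(1)] by metis
  note q = flow_invariants[OF d p s]
  have "square_solution d K t (flow d (flow d p s))"
    by (rule flow_square_solution[OF d q(1)]) (simp add: q(2) K)
  moreover have "square_solution d K t (\<lambda>r. flow d p (s + r))"
    unfolding square_solution_def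
  proof (intro ballI conjI)
    fix r assume r: "r \<in> {0..t}"
    then show "flow d p (s + r) \<in> square K"
      using flow_square_solution[OF d p K(2), of "s + t"] s by (auto simp: square_solution_def)
    have "(flow d p \<circ> (+) s has_vector_derivative 1 *\<^sub>R velocity d (flow d p (s + r))) (at r within {0..t})"
    proof (rule vector_diff_chain_within)
      show "((+) s has_vector_derivative 1) (at r within {0..t})"
        unfolding has_real_derivative_iff_has_vector_derivative[symmetric]
        by (auto intro!: derivative_eq_intros)
      show "(flow d p has_vector_derivative velocity d (flow d p (s + r))) (at (s + r) within (+) s ` {0..t})"
        by (rule has_vector_derivative_within_subset[OF flow_solves[OF d p]]) (use s r in auto)
    qed
    then show "((\<lambda>r. flow d p (s + r)) has_vector_derivative velocity d (flow d p (s + r))) (at r within {0..t})"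
      by (simp add: o_def)
  qed
  ultimately have "norm (flow d (flow d p s) t - flow d p (s + t))
      \<le> exp (C * t) * norm (flow d (flow d p s) 0 - flow d p (s + 0))"
    by (rule C[OF t])
  then show ?thesis by (simp add: flow_0[OF d q(1)])
qed

text \<open>The flow is continuous in time and Lipschitz in the initial point, locally uniformly in time.\<close>
lemma continuous_on_flow:
  assumes d: "0 < d"
  shows "continuous_on ({0..} \<times> quadrant) (\<lambda>(t, p). flow d p t)"
proof -
  have "local_lipschitz {0..} quadrant (\<lambda>t p. flow d p t)"
  proof (rule local_lipschitzI)
    fix t p assume tp: "t \<in> {0::real..}" "p \<in> quadrant"
    obtain u where u: "0 < u" "\<And>q. q \<in> quadrant \<Longrightarrow> dist q p < u \<Longrightarrow> dist (energy d q) (energy d p) < 1"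
      using continuous_on_energy[of d] tp(2) unfolding continuous_on_iff by (metis zero_less_one)
    define K where "K = max 1 (energy d p + 1)"
    have K: "1 \<le> K" by (simp add: K_def)
    obtain C where C0: "0 \<le> C" and C: "\<And>T f g. \<lbrakk>0 \<le> T; square_solution d K T f; square_solution d K T g\<rbrakk> \<Longrightarrow>
         norm (f T - g T) \<le> exp (C * T) * norm (f 0 - g 0)"
      using square_solutions_diverge_exponentially[OF d K] by metis
    have sol: "square_solution d K s (flow d q)" if "q \<in> cball p (u / 2) \<inter> quadrant" for q s
    proof (rule flow_square_solution[OF d])
      have "dist q p < u" using that u(1) by (auto simp: dist_commute)
      then show "energy d q \<le> K" using u(2)[of q] that by (auto simp: dist_real_def K_def)
    qed (use that in auto)
    have "(exp (C * (t + u / 2)))-lipschitz_on (cball p (u / 2) \<inter> quadrant) (\<lambda>q. flow d q s)"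
      if s: "s \<in> cball t (u / 2) \<inter> {0..}" for s
    proof (rule lipschitz_onI)
      fix q q' assume q: "q \<in> cball p (u / 2) \<inter> quadrant" "q' \<in> cball p (u / 2) \<inter> quadrant"
      have "norm (flow d q s - flow d q' s) \<le> exp (C * s) * norm (flow d q 0 - flow d q' 0)"
        by (rule C) (use s sol q in auto)
      also have "\<dots> = exp (C * s) * norm (q - q')" using q flow_0[OF d] by simp
      also have "\<dots> \<le> exp (C * (t + u / 2)) * norm (q - q')"
      proof (intro mult_right_mono)
        have "\<bar>t - s\<bar> \<le> u / 2" using s by (simp add: dist_real_def)
        then have "s \<le> t + u / 2" by linarith
        then show "exp (C * s) \<le> exp (C * (t + u / 2))" using C0 by (simp add: mult_left_mono)
      qed simp
      finally show "dist (flow d q s) (flow d q' s) \<le> exp (C * (t + u / 2)) * dist q q'"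
        by (simp add: dist_norm)
    qed simp
    then show "\<exists>u>0. \<exists>L. \<forall>t\<in>cball t u \<inter> {0..}. L-lipschitz_on (cball p u \<inter> quadrant) (\<lambda>p. flow d p t)"
      using half_gt_zero[OF u(1)] by blast
  qed
  moreover have "continuous_on {0..} (flow d p)" if "p \<in> quadrant" for p
    using flow_solves[OF d that] has_vector_derivative_continuous
    unfolding continuous_on_eq_continuous_within by fastforce
  ultimately show ?thesis by (intro continuous_on_TimesI) auto
qed

section \<open>Return times of the flow\<close>

text \<open>Flowing for the time \<open>4 * step_time\<close> performs four steps, and flowing for the time \<open>four_step_time\<close> does
the same; so the difference is a return time of every point of the level. It need not be the smallest
one.\<close>
definition period :: "real \<Rightarrow> real \<Rightarrow> real" where
  "period d k = 4 * step_time d k - four_step_time d k"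

lemma period_pos: "0 < d \<Longrightarrow> 0 < k \<Longrightarrow> 0 < period d k"
  using four_step_time_bounds[of d k] by (simp add: period_def)

text \<open>Flow from \<open>p\<close> for the return time to be tested and then for \<open>four_step_time\<close>: the total time is
\<open>4 * step_time\<close>. Both ways of reading this give the fourth iterate of a point, and \<open>step\<close> is injective.\<close>
lemma flow_period:
  assumes d: "0 < d" and p: "p \<in> quadrant"
  shows "flow d p (period d (energy d p)) = p"
proof -
  let ?A = "four_step_time d (energy d p)" and ?q = "flow d p (period d (energy d p))"
  have k: "0 < energy d p" using energy_pos[OF d p] .
  have q: "?q \<in> quadrant" "energy d ?q = energy d p"
    using flow_invariants[OF d p] period_pos[OF d k] by (simp_all add: less_imp_le)
  have "(step d ^^ 4) ?q = flow d ?q ?A" using flow_four_step[OF d q(1)] by (simp add: q(2))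
  also have "\<dots> = flow d p (period d (energy d p) + ?A)"
    using flow_add[OF d p] period_pos[OF d k] four_step_time_bounds[OF d k] by (simp add: less_imp_le)
  also have "\<dots> = (step d ^^ 4) p" using flow_step[OF d p, of 4] by (simp add: period_def)
  finally have eq: "(step d ^^ 4) ?q = (step d ^^ 4) p" .
  have "(step d ^^ n) a = (step d ^^ n) b \<Longrightarrow> a = b" if "a \<in> quadrant" "b \<in> quadrant" for n a b
    by (induction n) (use step_inj[OF d] step_iterate(1)[OF d] that in auto)
  with eq q p show ?thesis by blast
qed

lemma flow_add_return_time:
  assumes d: "0 < d" and p: "p \<in> quadrant" and s: "0 \<le> s" "flow d p s = p" and t: "0 \<le> t"
  shows "flow d p (t + of_nat n * s) = flow d p t"
proof (induction n)
  case (Suc n)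
  have "flow d p (t + of_nat (Suc n) * s) = flow d (flow d p s) (t + of_nat n * s)"
    using flow_add[OF d p s(1), of "t + of_nat n * s"] s t by (simp add: algebra_simps)
  then show ?case using Suc s by simp
qed simp

lemma velocity_zero_imp_fixed_point:
  assumes d: "0 < d" and p: "p \<in> quadrant" and z: "velocity d p = 0"
  shows "p = L d"
proof -
  obtain x y where xy: "p = (x, y)" "0 < x" "0 < y" using p by (auto simp: quadrant_def)
  have "x * y * y = x + d" "x * x * y = y + d"
    using z xy by (simp_all add: velocity_def zero_prod_def field_simps)
  then have "(x - y) * (x * y + 1) = 0" by algebra
  moreover have "0 < x * y" using xy by simp
  ultimately have "x = y" by auto
  with \<open>x * y * y = x + d\<close> have "x ^ 3 - x - d = 0" by (simp add: power3_eq_cube)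
  then have "ell d = x" unfolding ell_def
    using ell_ex1[OF d] xy by (intro the1_equality) auto
  then show ?thesis using \<open>x = y\<close> xy by (simp add: L_def)
qed

text \<open>Along arbitrarily small return times the difference quotients of the flow at time \<open>0\<close> vanish, hence
the velocity vanishes.\<close>
lemma small_return_times_imp_fixed_point:
  assumes d: "0 < d" and p: "p \<in> quadrant"
    and small: "\<And>e. 0 < e \<Longrightarrow> \<exists>t. 0 < t \<and> t < e \<and> flow d p t = p"
  shows "p = L d"
proof (rule velocity_zero_imp_fixed_point[OF d p], rule ccontr)
  define X where "X = velocity d p"
  assume "velocity d p \<noteq> 0"
  then have X: "0 < norm X" by (simp add: X_def)
  have "(flow d p has_vector_derivative X) (at 0 within {0..})"
    using flow_solves[OF d p, of 0] by (simp add: X_def flow_0[OF d p])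
  then obtain e where e: "0 < e"
    "\<And>t. t \<in> {0..} \<Longrightarrow> norm (t - 0) < e \<Longrightarrow> norm (flow d p t - flow d p 0 - (t - 0) *\<^sub>R X) \<le> norm X / 2 * norm (t - 0)"
    using X unfolding has_vector_derivative_def has_derivative_within_alt by (metis half_gt_zero)
  obtain t where t: "0 < t" "t < e" "flow d p t = p" using small[OF e(1)] by blast
  have "t * norm X \<le> norm X / 2 * t" using e(2)[of t] t by (simp add: flow_0[OF d p])
  then show False using X t by simp
qed

text \<open>Return times are closed under multiples and differences. If \<open>r\<close> and \<open>1\<close> times the period were both
return times, then so would be \<open>\<bar>k r - h\<bar>\<close> times the period for integers \<open>k > 0\<close>, \<open>h \<ge> 0\<close>; by
Dirichlet's approximation theorem these can be made arbitrarily small, and they are positive because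
\<open>r\<close> is irrational.\<close>
lemma flow_irrational_multiple_of_period:
  assumes d: "0 < d" and p: "p \<in> quadrant" "p \<noteq> L d" and r: "0 < r" "r \<notin> \<rat>"
  shows "flow d p (r * period d (energy d p)) \<noteq> p"
proof
  define T where "T = period d (energy d p)"
  have T: "0 < T" unfolding T_def using period_pos[OF d] energy_pos[OF d p(1)] .
  have fT: "flow d p T = p" unfolding T_def by (rule flow_period[OF d p(1)])
  assume "flow d p (r * period d (energy d p)) = p"
  then have frT: "flow d p (r * T) = p" by (simp add: T_def)
  have mult: "flow d p (of_nat n * s) = p" if "0 \<le> s" "flow d p s = p" for n s
    using flow_add_return_time[OF d p(1) that order_refl, of n] by (simp add: flow_0[OF d p(1)])
  have diff: "flow d p (t - s) = p" if "0 \<le> s" "s \<le> t" "flow d p s = p" "flow d p t = p" for s t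
    using flow_add[OF d p(1) that(1), of "t - s"] that by simp
  have "\<exists>t. 0 < t \<and> t < e \<and> flow d p t = p" if e: "0 < e" for e
  proof -
    obtain N :: nat where N: "T / e < N" using reals_Archimedean2 by blast
    have "0 < N" using N T e by (metis divide_pos_pos less_trans of_nat_0_less_iff)
    then obtain h k :: int where hk: "0 < k" "\<bar>of_int k * r - of_int h\<bar> < 1 / N"
      using Dirichlet_approx[of N r] by metis
    have "0 < of_int k * r" using hk r by simp
    moreover have "1 / real N \<le> 1" using \<open>0 < N\<close> by simp
    ultimately have "- 1 < real_of_int h" using hk(2) by linarith
    then have h0: "0 \<le> h" by linarith
    have ne: "of_int k * r \<noteq> of_int h"
    proof
      assume "of_int k * r = of_int h"
      then have "r = of_int h / of_int k" using hk(1) by (simp add: field_simps)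
      then show False using r(2) by simp
    qed
    define t where "t = \<bar>of_int k * r - of_int h\<bar> * T"
    have "t < 1 / N * T" unfolding t_def using hk(2) T by (intro mult_strict_right_mono)
    also have "\<dots> < e" using N T e \<open>0 < N\<close> by (simp add: field_simps)
    finally have "t < e" .
    moreover have "0 < t" using ne T by (simp add: t_def)
    moreover have "flow d p t = p"
    proof -
      have a: "flow d p (of_int k * r * T) = p" "flow d p (of_int h * T) = p"
        using mult[OF _ frT, of "nat k"] mult[OF _ fT, of "nat h"] hk h0 r T by (simp_all add: mult.assoc)
      show ?thesis
      proof (cases "of_int h \<le> of_int k * r")
        case True
        then have "t = of_int k * r * T - of_int h * T" by (simp add: t_def algebra_simps)
        moreover have "of_int h * T \<le> of_int k * r * T" using True T by (intro mult_right_mono) auto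
        ultimately show ?thesis using diff[of "of_int h * T" "of_int k * r * T"] a h0 T by simp
      next
        case False
        then have "t = of_int h * T - of_int k * r * T" by (simp add: t_def algebra_simps)
        moreover have "of_int k * r * T \<le> of_int h * T" using False T by (intro mult_right_mono) auto
        ultimately show ?thesis using diff[of "of_int k * r * T" "of_int h * T"] a hk r T by simp
      qed
    qed
    ultimately show ?thesis by blast
  qed
  then show False using small_return_times_imp_fixed_point[OF d p(1)] p(2) by blast
qed

section \<open>The two elliptic integrals\<close>

text \<open>The time \<open>four_step_time\<close> after the substitution \<open>v = - (k + d) z\<close>, which makes the limits of
integration independent of \<open>k\<close>.\<close>
definition left_integral :: "real \<Rightarrow> real \<Rightarrow> real" where
  "left_integral d k = integral {0..d} (\<lambda>z. 1 / sqrt ((1 + k * z)\<^sup>2 + 4 * z\<^sup>2 + 4 * (k + d) * z ^ 3))"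

text \<open>The remaining part of \<open>step_time\<close>, from \<open>v = 0\<close> to \<open>v = 1\<close>, after the substitution \<open>v = 1 - u\<close>.\<close>
definition right_integral :: "real \<Rightarrow> real \<Rightarrow> real" where
  "right_integral d k = integral {0..1} (\<lambda>u. 1 / sqrt ((d + k * u)\<^sup>2 + 4 * u * (1 - u)\<^sup>2))"

text \<open>The integrals are meaningful for all \<open>k > - d\<close>. The proof that their ratio varies works with \<open>k\<close> near
\<open>- d\<close>, where \<open>k\<close> is not the energy of any point.\<close>
lemma left_radicand_pos:
  fixes d k z :: real
  assumes "- d < k" "0 \<le> z" shows "0 < (1 + k * z)\<^sup>2 + 4 * z\<^sup>2 + 4 * (k + d) * z ^ 3"
proof (cases "z = 0")
  case False
  then have "0 < 4 * z\<^sup>2" "0 \<le> 4 * (k + d) * z ^ 3" using assms by simp_all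
  then show ?thesis using zero_le_power2[of "1 + k * z"] by linarith
qed simp

lemma right_radicand_pos:
  fixes d k u :: real
  assumes "0 < d" "- d < k" "0 \<le> u" "u \<le> 1" shows "0 < (d + k * u)\<^sup>2 + 4 * u * (1 - u)\<^sup>2"
proof (cases "u = 0 \<or> u = 1")
  case False
  then have "0 < 4 * u * (1 - u)\<^sup>2" using assms by simp
  then show ?thesis using zero_le_power2[of "d + k * u"] by linarith
qed (use assms in auto)

lemma four_step_time_eq_left_integral:
  assumes d: "0 < d" and k: "0 < k"
  shows "four_step_time d k = left_integral d k"
proof -
  let ?f = "\<lambda>v. 1 / sqrt (cubic d k v)" and ?r = "\<lambda>z. (1 + k * z)\<^sup>2 + 4 * z\<^sup>2 + 4 * (k + d) * z ^ 3"
  define m where "m = k + d"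
  have m: "0 < m" using d k by (simp add: m_def)
  have "(?f has_integral four_step_time d k) (cbox (- d * m) 0)"
    unfolding four_step_time_def transit_def m_def cbox_interval
    by (intro integrable_integral integrable_continuous_real continuous_on_inverse_sqrt_cubic d k) simp
  from has_integral_affinity[OF this, of "- m" 0]
  have "((\<lambda>z. ?f (- m * z)) has_integral (1 / m) * four_step_time d k) ((\<lambda>x. - (x / m)) ` {- d * m..0})"
    using m by simp
  moreover have "(\<lambda>x. - (x / m)) ` {- d * m..0} = {0..d}"
  proof (intro equalityI subsetI)
    fix z assume "z \<in> {0..d}"
    then show "z \<in> (\<lambda>x. - (x / m)) ` {- d * m..0}"
      using m by (intro image_eqI[of _ _ "- z * m"]) auto
  qed (use m in \<open>auto simp: field_simps\<close>)
  ultimately have "((\<lambda>z. m * ?f (- m * z)) has_integral m * ((1 / m) * four_step_time d k)) {0..d}"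
    by (intro has_integral_mult_right) simp
  then have "((\<lambda>z. m * ?f (- m * z)) has_integral four_step_time d k) {0..d}" using m by simp
  moreover have "m * ?f (- m * z) = 1 / sqrt (?r z)" for z
  proof -
    have "cubic d k (- m * z) = m\<^sup>2 * ?r z" unfolding cubic_def m_def by algebra
    then show ?thesis using m by (simp add: real_sqrt_mult)
  qed
  ultimately show ?thesis unfolding left_integral_def by (simp add: integral_unique)
qed

lemma step_time_eq:
  assumes d: "0 < d" and k: "0 < k"
  shows "step_time d k = left_integral d k + right_integral d k"
proof -
  let ?f = "\<lambda>v. 1 / sqrt (cubic d k v)"
  have "(?f has_integral transit d k 0 1) (cbox 0 1)"
    unfolding transit_def cbox_interval
    by (intro integrable_integral integrable_continuous_real continuous_on_inverse_sqrt_cubic d k) simp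
  from has_integral_affinity[OF this, of "- 1" 1]
  have "((\<lambda>u. ?f (1 - u)) has_integral transit d k 0 1) ((\<lambda>x. 1 - x) ` {0..1})"
    by simp
  moreover have "(\<lambda>x. 1 - x) ` {0..1::real} = {0..1}" by (simp add: image_minus_const_AtMost)
  moreover have "cubic d k (1 - u) = (d + k * u)\<^sup>2 + 4 * u * (1 - u)\<^sup>2" for u
    unfolding cubic_def by algebra
  ultimately have "transit d k 0 1 = right_integral d k" unfolding right_integral_def by (simp add: integral_unique)
  moreover have "four_step_time d k + transit d k 0 1 = step_time d k"
    unfolding four_step_time_def step_time_def by (rule transit_combine) (use d k in auto)
  ultimately show ?thesis using four_step_time_eq_left_integral[OF d k] by simp
qed

lemma continuous_on_left_integral: "0 < d \<Longrightarrow> continuous_on {0<..} (left_integral d)"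
  unfolding left_integral_def[abs_def] cbox_interval[symmetric]
proof (rule integral_continuous_on_param)
  assume d: "0 < d"
  have "(1 + k * z)\<^sup>2 + 4 * z\<^sup>2 + 4 * (k + d) * z ^ 3 \<noteq> 0" if "k \<in> {0<..}" "z \<in> {0..d}" for k z
    using left_radicand_pos[of d k z] that d by simp
  then show "continuous_on ({0<..} \<times> cbox 0 d) (\<lambda>(k, z). 1 / sqrt ((1 + k * z)\<^sup>2 + 4 * z\<^sup>2 + 4 * (k + d) * z ^ 3))"
    unfolding case_prod_unfold cbox_interval by (intro continuous_intros) auto
qed

lemma continuous_on_right_integral: "0 < d \<Longrightarrow> continuous_on {0<..} (right_integral d)"
  unfolding right_integral_def[abs_def] cbox_interval[symmetric]
proof (rule integral_continuous_on_param)
  assume d: "0 < d"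
  have "(d + k * u)\<^sup>2 + 4 * u * (1 - u)\<^sup>2 \<noteq> 0" if "k \<in> {0<..}" "u \<in> {0..1}" for k u
    using right_radicand_pos[of d k u] that d by simp
  then show "continuous_on ({0<..} \<times> cbox 0 1) (\<lambda>(k, u). 1 / sqrt ((d + k * u)\<^sup>2 + 4 * u * (1 - u)\<^sup>2))"
    unfolding case_prod_unfold cbox_interval by (intro continuous_intros) auto
qed

section \<open>The ratio of the two integrals is not locally constant\<close>

text \<open>By compactness, positivity of the real part for real \<open>k\<close> extends to a thin rectangle around the
interval. There the principal square root is holomorphic and the integral can be differentiated under
the integral sign.\<close>
lemma integral_inverse_csqrt_holomorphic:
  fixes P P' :: "complex \<Rightarrow> real \<Rightarrow> complex"
  assumes P: "\<And>k z. ((\<lambda>k. P k z) has_field_derivative P' k z) (at k)"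
    and cont: "continuous_on UNIV (\<lambda>(k, z). P k z)" "continuous_on UNIV (\<lambda>(k, z). P' k z)"
    and pos: "\<And>k z. k \<in> {a..b} \<Longrightarrow> z \<in> {0..c} \<Longrightarrow> 0 < Re (P (of_real k) z)"
  obtains e where "0 < e"
    "(\<lambda>k. integral {0..c} (\<lambda>z. 1 / csqrt (P k z))) holomorphic_on {k. Re k \<in> {a<..<b} \<and> \<bar>Im k\<bar> < e}"
proof -
  define R where "R = (\<lambda>(k, z). (complex_of_real k, z)) ` ({a..b} \<times> {0..c})"
  have "compact R" unfolding R_def
    by (intro compact_continuous_image compact_Times compact_Icc)
       (auto simp: case_prod_unfold intro!: continuous_intros)
  moreover have "open {x. 0 < Re ((\<lambda>(k, z). P k z) x)}"
    by (intro open_Collect_less continuous_intros cont)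
  moreover have "R \<subseteq> {x. 0 < Re ((\<lambda>(k, z). P k z) x)}"
    using pos by (auto simp: R_def)
  ultimately obtain e where e: "0 < e" "(\<Union>x\<in>R. ball x e) \<subseteq> {x. 0 < Re ((\<lambda>(k, z). P k z) x)}"
    by (rule compact_subset_open_imp_ball_epsilon_subset)
  define S where "S = {k. Re k \<in> {a<..<b} \<and> \<bar>Im k\<bar> < e}"
  have posS: "0 < Re (P k z)" if "k \<in> S" "z \<in> {0..c}" for k z
  proof -
    have R: "(complex_of_real (Re k), z) \<in> R" using that by (auto simp: R_def S_def)
    have "dist (complex_of_real (Re k)) k = \<bar>Im k\<bar>"
      by (simp add: dist_norm cmod_def)
    then have "(k, z) \<in> ball (complex_of_real (Re k), z) e"
      using that by (simp add: S_def dist_prod_def)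
    with R have "(k, z) \<in> (\<Union>x\<in>R. ball x e)" by (rule UN_I)
    from subsetD[OF e(2) this] show ?thesis by simp
  qed
  then have nonpos: "P k z \<notin> \<real>\<^sub>\<le>\<^sub>0" if "k \<in> S" "z \<in> {0..c}" for k z
    using that by (metis complex_nonpos_Reals_iff not_less)
  have "S = {k. a < Re k} \<inter> {k. Re k < b} \<inter> {k. Im k < e} \<inter> {k. - e < Im k}"
    by (auto simp: S_def)
  then have "convex S"
    by (simp add: convex_Int convex_halfspace_Re_gt convex_halfspace_Re_lt convex_halfspace_Im_gt convex_halfspace_Im_lt)
  have sub: "(\<lambda>(k, z). P k z) ` (S \<times> {0..c}) \<subseteq> - \<real>\<^sub>\<le>\<^sub>0" using nonpos by auto
  have cs: "continuous_on (S \<times> {0..c}) (\<lambda>(k, z). csqrt (P k z))"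
    using continuous_on_compose2[OF continuous_on_csqrt continuous_on_subset[OF cont(1)] sub]
    by (simp add: case_prod_unfold)
  have nz: "csqrt (P k z) \<noteq> 0" if "k \<in> S" "z \<in> {0..c}" for k z
    using posS[OF that] by auto
  have "(\<lambda>k. integral (cbox 0 c) (\<lambda>z. 1 / csqrt (P k z))) holomorphic_on S"
  proof (rule leibniz_rule_holomorphic[where fx = "\<lambda>k z. - (P' k z / (2 * csqrt (P k z))) / (csqrt (P k z) * csqrt (P k z))"])
    fix k z assume kz: "k \<in> S" "z \<in> cbox 0 c"
    then have dc: "((\<lambda>k. csqrt (P k z)) has_field_derivative P' k z / (2 * csqrt (P k z))) (at k within S)"
      using nonpos by (intro has_field_derivative_csqrt' has_field_derivative_at_within[OF P]) auto
    have "csqrt (P k z) \<noteq> 0" using nz kz by simp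
    from DERIV_divide[OF DERIV_const[of 1] dc this]
    show "((\<lambda>k. 1 / csqrt (P k z)) has_field_derivative - (P' k z / (2 * csqrt (P k z))) / (csqrt (P k z) * csqrt (P k z))) (at k within S)"
      by simp
  next
    fix k assume k: "k \<in> S"
    have "continuous_on {0..c} (\<lambda>z. csqrt (P k z))"
    proof -
      have "continuous_on {0..c} (\<lambda>z. (k, z))" by (intro continuous_intros)
      moreover have "(\<lambda>z. (k, z)) ` {0..c} \<subseteq> S \<times> {0..c}" using k by auto
      ultimately show ?thesis using continuous_on_compose2[OF cs, of "{0..c}" "\<lambda>z. (k, z)"] by simp
    qed
    then show "(\<lambda>z. 1 / csqrt (P k z)) integrable_on cbox 0 c"
      unfolding cbox_interval using nz k
      by (intro integrable_continuous_real continuous_intros) auto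
  next
    show "continuous_on (S \<times> cbox 0 c) (\<lambda>(k, z). - (P' k z / (2 * csqrt (P k z))) / (csqrt (P k z) * csqrt (P k z)))"
      using cs continuous_on_subset[OF cont(2) subset_UNIV, of "S \<times> {0..c}"] nz
      unfolding case_prod_unfold cbox_interval
      by (auto intro!: continuous_intros)
  qed (fact \<open>convex S\<close>)
  with e(1) show ?thesis by (intro that) (simp_all add: S_def)
qed

lemma of_real_integral_inverse_sqrt:
  fixes r :: "real \<Rightarrow> real"
  assumes "continuous_on {0..c} r" "\<And>z. z \<in> {0..c} \<Longrightarrow> 0 < r z"
  shows "integral {0..c} (\<lambda>z. 1 / csqrt (of_real (r z))) = of_real (integral {0..c} (\<lambda>z. 1 / sqrt (r z)))"
proof -
  have "continuous_on {0..c} (\<lambda>z. 1 / sqrt (r z))"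
    using assms by (intro continuous_intros) force+
  then have "((\<lambda>z. 1 / sqrt (r z)) has_integral integral {0..c} (\<lambda>z. 1 / sqrt (r z))) {0..c}"
    by (intro integrable_integral integrable_continuous_real)
  then have "((\<lambda>z. complex_of_real (1 / sqrt (r z))) has_integral of_real (integral {0..c} (\<lambda>z. 1 / sqrt (r z)))) {0..c}"
    by (rule has_integral_of_real)
  then have "((\<lambda>z. 1 / csqrt (of_real (r z))) has_integral of_real (integral {0..c} (\<lambda>z. 1 / sqrt (r z)))) {0..c}"
    by (rule has_integral_eq[rotated]) (use assms(2) in \<open>simp add: csqrt_of_real less_imp_le\<close>)
  then show ?thesis by (rule integral_unique)
qed

text \<open>For fixed \<open>k\<close> the minimum of \<open>(1 + k z)\<^sup>2 + 4 z\<^sup>2\<close> over all \<open>z\<close> is \<open>4 / (k\<^sup>2 + 4)\<close>.\<close>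
lemma left_integral_bounded:
  assumes d: "0 < d" and k: "- d < k" "k < 0"
  shows "left_integral d k \<le> d * sqrt (d\<^sup>2 + 4)"
proof -
  let ?r = "\<lambda>z. (1 + k * z)\<^sup>2 + 4 * z\<^sup>2 + 4 * (k + d) * z ^ 3"
  have c: "continuous_on {0..d} (\<lambda>z. 1 / sqrt (?r z))"
    using left_radicand_pos[OF k(1)] by (intro continuous_intros) force
  have "left_integral d k \<le> integral {0..d} (\<lambda>z. sqrt (d\<^sup>2 + 4))"
    unfolding left_integral_def
  proof (rule integral_le)
    show "(\<lambda>z. 1 / sqrt (?r z)) integrable_on {0..d}" by (rule integrable_continuous_real[OF c])
    fix z assume z: "z \<in> {0..d}"
    have "k\<^sup>2 \<le> d\<^sup>2" using k by (simp add: abs_le_square_iff[symmetric])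
    have "4 \<le> (d\<^sup>2 + 4) * ((1 + k * z)\<^sup>2 + 4 * z\<^sup>2)"
    proof -
      have "(k\<^sup>2 + 4) * ((1 + k * z)\<^sup>2 + 4 * z\<^sup>2) = 4 + (k + (k\<^sup>2 + 4) * z)\<^sup>2"
        by algebra
      moreover have "(k\<^sup>2 + 4) * ((1 + k * z)\<^sup>2 + 4 * z\<^sup>2) \<le> (d\<^sup>2 + 4) * ((1 + k * z)\<^sup>2 + 4 * z\<^sup>2)"
        using \<open>k\<^sup>2 \<le> d\<^sup>2\<close> by (intro mult_right_mono) auto
      ultimately show ?thesis using zero_le_power2[of "k + (k\<^sup>2 + 4) * z"] by linarith
    qed
    also have "\<dots> \<le> (d\<^sup>2 + 4) * ?r z"
      using z k by (intro mult_left_mono) auto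
    finally have "1 \<le> (d\<^sup>2 + 4) * ?r z" by simp
    then have "1 \<le> sqrt (d\<^sup>2 + 4) * sqrt (?r z)" by (simp flip: real_sqrt_mult)
    then show "1 / sqrt (?r z) \<le> sqrt (d\<^sup>2 + 4)"
      using left_radicand_pos[OF k(1), of z] z by (simp add: divide_le_eq)
  qed (rule integrable_const_ivl)
  then show ?thesis using d by (simp add: mult.commute)
qed

text \<open>With \<open>e = k + d\<close> the radicand is at most \<open>((d + 2) (1 - u) + e)\<^sup>2\<close>, and the integral of the reciprocal of
\<open>(d + 2) (1 - u) + e\<close> diverges logarithmically for \<open>e\<close> tending to \<open>0\<close>.\<close>
lemma right_integral_ge_log:
  assumes d: "0 < d" and e: "0 < e"
  shows "- ln e / (d + 2) \<le> right_integral d (e - d)"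
proof -
  let ?r = "\<lambda>u. (d + (e - d) * u)\<^sup>2 + 4 * u * (1 - u)\<^sup>2"
  let ?l = "\<lambda>u. - ln ((d + 2) * (1 - u) + e) / (d + 2)"
  have lp: "0 < (d + 2) * (1 - u) + e" if "u \<in> {0..1}" for u
    using that d e by (simp add: add_nonneg_pos)
  have hi: "((\<lambda>u. 1 / ((d + 2) * (1 - u) + e)) has_integral (?l 1 - ?l 0)) {0..1}"
  proof (rule fundamental_theorem_of_calculus)
    fix u :: real assume u: "u \<in> {0..1}"
    show "(?l has_vector_derivative 1 / ((d + 2) * (1 - u) + e)) (at u within {0..1})"
    proof -
      define h where "h u = (d + 2) * (1 - u) + e" for u
      have "(h has_real_derivative - (d + 2)) (at u within {0..1})"
        unfolding h_def[abs_def] by (auto intro!: derivative_eq_intros)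
      moreover have "0 < h u" using lp[OF u] by (simp add: h_def)
      ultimately have "((\<lambda>u. - ln (h u) / (d + 2)) has_real_derivative 1 / h u) (at u within {0..1})"
        using d by (auto intro!: derivative_eq_intros simp: divide_simps)
      then show ?thesis by (simp add: h_def has_real_derivative_iff_has_vector_derivative)
    qed
  qed simp
  have c: "continuous_on {0..1} (\<lambda>u. 1 / sqrt (?r u))"
    using right_radicand_pos[OF d, of "e - d"] e by (intro continuous_intros) force
  have "?l 1 - ?l 0 \<le> right_integral d (e - d)" unfolding right_integral_def
  proof (rule has_integral_le[OF hi integrable_integral[OF integrable_continuous_real[OF c]]])
    fix u :: real assume u: "u \<in> {0..1}"
    define s where "s = 1 - u"
    have s: "0 \<le> s" "s \<le> 1" "u = 1 - s" using u by (auto simp: s_def)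
    have "?r u \<le> ((d + 2) * s + e)\<^sup>2"
    proof -
      have "d + (e - d) * u \<le> d * s + e" "0 \<le> d + (e - d) * u"
      proof -
        have "d + (e - d) * u = d * s + e * u" by (simp add: s_def algebra_simps)
        moreover have "e * u \<le> e" "0 \<le> e * u" "0 \<le> d * s"
          using u s d e by (simp_all add: mult_left_le)
        ultimately show "d + (e - d) * u \<le> d * s + e" "0 \<le> d + (e - d) * u" by linarith+
      qed
      then have "(d + (e - d) * u)\<^sup>2 \<le> (d * s + e)\<^sup>2" by (intro power_mono)
      moreover have "4 * u * s\<^sup>2 \<le> 4 * s\<^sup>2" using u by (intro mult_right_mono) auto
      moreover have "0 \<le> 4 * s * (d * s + e)" using s d e by simp
      moreover have "((d + 2) * s + e)\<^sup>2 = (d * s + e)\<^sup>2 + 4 * s * (d * s + e) + 4 * s\<^sup>2"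
        by algebra
      ultimately show ?thesis by (simp add: s_def)
    qed
    then have "sqrt (?r u) \<le> (d + 2) * (1 - u) + e"
      using lp[OF u] by (simp add: real_le_lsqrt s_def less_imp_le)
    then show "1 / ((d + 2) * (1 - u) + e) \<le> 1 / sqrt (?r u)"
      using right_radicand_pos[OF d, of "e - d" u] e u by (intro frac_le) auto
  qed
  moreover have "?l 1 - ?l 0 = ln (d + 2 + e) / (d + 2) - ln e / (d + 2)" by simp
  moreover have "0 \<le> ln (d + 2 + e) / (d + 2)" using d e by simp
  ultimately show ?thesis by simp
qed

text \<open>By analytic continuation a relation \<open>left = c right\<close> on one interval would hold for all smaller
\<open>k > - d\<close> as well; but near \<open>- d\<close> the left integral is bounded and the right one is not.\<close>
lemma left_right_ratio_nonconstant:
  assumes d: "0 < d" and ab: "0 < a" "a < b"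
    and const: "\<And>k. k \<in> {a<..<b} \<Longrightarrow> left_integral d k = c * right_integral d k"
    and c: "0 < c"
  shows False
proof -
  \<comment> \<open>At \<open>k0 = exp (- N) - d\<close> the logarithmic lower bound for the right integral, multiplied by \<open>c\<close>,
    exceeds the upper bound for the left one; the second argument of the maximum ensures \<open>k0 < 0\<close>.\<close>
  define N where "N = max ((d + 2) * (d * sqrt (d\<^sup>2 + 4) + 1) / c) (1 - ln d)"
  define e where "e = exp (- N)"
  have e: "0 < e" "e < d"
  proof -
    have "- N < ln d" by (simp add: N_def max_def)
    then have "exp (- N) < exp (ln d)" by (subst exp_less_cancel_iff)
    then show "0 < e" "e < d" using d by (simp_all add: e_def)
  qed
  define k0 where "k0 = e - d"
  have k0: "- d < k0" "k0 < 0" using e by (simp_all add: k0_def)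
  have "(d + 2) * (d * sqrt (d\<^sup>2 + 4) + 1) / c \<le> N" by (simp add: N_def)
  then have "d * sqrt (d\<^sup>2 + 4) + 1 \<le> c * (N / (d + 2))" using c d by (simp add: field_simps)
  also have "\<dots> \<le> c * right_integral d k0"
    using right_integral_ge_log[OF d e(1)] c by (intro mult_left_mono) (simp_all add: e_def k0_def)
  finally have ne: "left_integral d k0 \<noteq> c * right_integral d k0"
    using left_integral_bounded[OF d k0] by linarith
  \<comment> \<open>The rectangle of holomorphy has to contain \<open>k0\<close> in its interior, so it starts at a point strictly
    between \<open>- d\<close> and \<open>k0\<close>.\<close>
  define l where "l = (k0 - d) / 2"
  have l: "- d < l" "l < k0" using k0 by (simp_all add: l_def)
  define P where "P k z = (1 + k * of_real z)\<^sup>2 + 4 * (of_real z)\<^sup>2 + 4 * (k + of_real d) * (of_real z) ^ 3" for k :: complex and z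
  define Q where "Q k u = (of_real d + k * of_real u)\<^sup>2 + 4 * of_real u * (1 - of_real u)\<^sup>2" for k :: complex and u
  have P_real: "P (of_real k) z = of_real ((1 + k * z)\<^sup>2 + 4 * z\<^sup>2 + 4 * (k + d) * z ^ 3)" for k z
    by (simp add: P_def)
  have Q_real: "Q (of_real k) u = of_real ((d + k * u)\<^sup>2 + 4 * u * (1 - u)\<^sup>2)" for k u
    by (simp add: Q_def)
  obtain e1 where e1: "0 < e1"
    "(\<lambda>k. integral {0..d} (\<lambda>z. 1 / csqrt (P k z))) holomorphic_on {k. Re k \<in> {l<..<b} \<and> \<bar>Im k\<bar> < e1}"
  proof (rule integral_inverse_csqrt_holomorphic[of P "\<lambda>k z. 2 * (1 + k * of_real z) * of_real z + 4 * (of_real z) ^ 3" l b d])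
    show "((\<lambda>k. P k z) has_field_derivative 2 * (1 + k * of_real z) * of_real z + 4 * (of_real z) ^ 3) (at k)" for k z
      unfolding P_def by (auto intro!: derivative_eq_intros)
    show "0 < Re (P (of_real k) z)" if "k \<in> {l..b}" "z \<in> {0..d}" for k z
      using left_radicand_pos[of d k z] l that by (simp add: P_real del: of_real_add of_real_mult of_real_power)
  qed (unfold P_def case_prod_unfold, intro continuous_intros, intro continuous_intros, blast)
  obtain e2 where e2: "0 < e2"
    "(\<lambda>k. integral {0..1} (\<lambda>u. 1 / csqrt (Q k u))) holomorphic_on {k. Re k \<in> {l<..<b} \<and> \<bar>Im k\<bar> < e2}"
  proof (rule integral_inverse_csqrt_holomorphic[of Q "\<lambda>k u. 2 * (of_real d + k * of_real u) * of_real u" l b 1])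
    show "((\<lambda>k. Q k u) has_field_derivative 2 * (of_real d + k * of_real u) * of_real u) (at k)" for k u
      unfolding Q_def by (auto intro!: derivative_eq_intros)
    show "0 < Re (Q (of_real k) u)" if "k \<in> {l..b}" "u \<in> {0..1}" for k u
      using right_radicand_pos[of d k u] d l that by (simp add: Q_real del: of_real_add of_real_mult of_real_power)
  qed (unfold Q_def case_prod_unfold, intro continuous_intros, intro continuous_intros, blast)
  define S where "S = {k. Re k \<in> {l<..<b} \<and> \<bar>Im k\<bar> < min e1 e2}"
  define f where "f k = integral {0..d} (\<lambda>z. 1 / csqrt (P k z)) - of_real c * integral {0..1} (\<lambda>u. 1 / csqrt (Q k u))" for k
  have f_real: "f (of_real k) = of_real (left_integral d k - c * right_integral d k)" if "- d < k" for k
  proof -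
    have "integral {0..d} (\<lambda>z. 1 / csqrt (P (of_real k) z)) = of_real (left_integral d k)"
      unfolding P_real left_integral_def
      by (rule of_real_integral_inverse_sqrt) (use left_radicand_pos[OF that] in \<open>auto intro!: continuous_intros\<close>)
    moreover have "integral {0..1} (\<lambda>u. 1 / csqrt (Q (of_real k) u)) = of_real (right_integral d k)"
      unfolding Q_real right_integral_def
      by (rule of_real_integral_inverse_sqrt) (use right_radicand_pos[OF d that] in \<open>auto intro!: continuous_intros\<close>)
    ultimately show ?thesis by (simp add: f_def)
  qed
  have S_eq: "S = {k. l < Re k} \<inter> {k. Re k < b} \<inter> {k. Im k < min e1 e2} \<inter> {k. - min e1 e2 < Im k}"
    by (auto simp: S_def)
  have "open S" unfolding S_eq
    by (intro open_Int open_halfspace_Re_gt open_halfspace_Re_lt open_halfspace_Im_gt open_halfspace_Im_lt)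
  have "convex S" unfolding S_eq
    by (intro convex_Int convex_halfspace_Re_gt convex_halfspace_Re_lt convex_halfspace_Im_gt convex_halfspace_Im_lt)
  have "f holomorphic_on S" unfolding f_def
    by (intro holomorphic_intros holomorphic_on_subset[OF e1(2)] holomorphic_on_subset[OF e2(2)]) (auto simp: S_def)
  define m where "m = (a + b) / 2"
  have m: "a < m" "m < b" using ab by (simp_all add: m_def)
  have "f (of_real k0) = 0"
  proof (rule analytic_continuation[OF \<open>f holomorphic_on S\<close> \<open>open S\<close> convex_connected[OF \<open>convex S\<close>]])
    show "complex_of_real ` {a<..<b} \<subseteq> S" using ab l k0 e1 e2 by (auto simp: S_def)
    show "complex_of_real m \<in> S" using ab l k0 e1 e2 m by (auto simp: S_def)
    show "complex_of_real k0 \<in> S" using ab l k0 e1 e2 by (auto simp: S_def)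
    show "complex_of_real m islimpt complex_of_real ` {a<..<b}"
    proof -
      have "m islimpt {a<..<b}" using m by (intro interior_limit_point) simp
      then show ?thesis by (intro islimpt_isCont_image) (auto simp: eventually_at_filter)
    qed
    show "f k = 0" if k: "k \<in> complex_of_real ` {a<..<b}" for k
    proof -
      obtain x where x: "k = of_real x" "x \<in> {a<..<b}" using k by blast
      then show ?thesis using f_real[of x] const[of x] d ab by simp
    qed
  qed
  then show False using f_real[OF k0(1)] ne by (simp del: of_real_diff of_real_mult)
qed

section \<open>The rotation number\<close>

text \<open>The fraction of the return time \<open>period\<close> by which \<open>F d\<close>, that is two steps, advances a point along
the flow.\<close>
definition rotation :: "real \<Rightarrow> real \<times> real \<Rightarrow> real" where
  "rotation d p = 2 * step_time d (energy d p) / period d (energy d p)"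

lemma open_quadrant: "open quadrant"
  by (simp add: quadrant_def open_Times)

text \<open>On a horizontal line the energy is \<open>x + c / x\<close> plus a constant, so it takes each value at most twice;
three points on the line suffice.\<close>
lemma energy_nonconstant_near:
  assumes d: "0 < d" and M: "M \<in> quadrant" and e: "0 < e"
  obtains M' where "dist M' M < e" "energy d M' \<noteq> energy d M"
proof -
  obtain x y where xy: "M = (x, y)" "0 < x" "0 < y" using M by (auto simp: quadrant_def)
  have ex: "\<exists>t\<in>{e / 4, e / 2}. energy d (x + t, y) \<noteq> energy d (x, y)"
  proof (rule ccontr)
    assume "\<not> ?thesis"
    then have eq: "energy d (x + t, y) = energy d (x, y)" if "t \<in> {e / 4, e / 2}" for t using that by blast
    have "x * (x + t) = 1 + d / y" if t: "t \<in> {e / 4, e / 2}" for t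
    proof -
      have t0: "0 < t" using t e by auto
      define c where "c = 1 + d / y"
      have "x + t + c / (x + t) = x + c / x"
        using eq[OF t] xy t0 by (simp add: energy_def c_def add_divide_distrib mult.commute)
      then have "(x + t + c / (x + t)) * (x * (x + t)) = (x + c / x) * (x * (x + t))" by simp
      then have "(x + t) * (x * (x + t)) + c * x = x * (x * (x + t)) + c * (x + t)"
        using xy t0 by (simp add: distrib_right)
      then have "t * (x * (x + t)) = t * c" by algebra
      then show ?thesis using t0 by (simp add: c_def)
    qed
    from this[of "e / 4"] this[of "e / 2"] have "x * (x + e / 4) = x * (x + e / 2)" by simp
    then show False using xy e by simp
  qed
  then obtain t where t: "t \<in> {e / 4, e / 2}" "energy d (x + t, y) \<noteq> energy d M" using xy by blast
  show ?thesis
    by (rule that[of "(x + t, y)"]) (use t e xy in \<open>auto simp: dist_prod_def dist_real_def\<close>)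
qed

text \<open>The energies of the points near \<open>M\<close> fill an interval of levels. The step time is the sum of the left and the
right integral and the period is three times the left plus four times the right one, so the rotation
number determines the ratio of the two integrals.\<close>
lemma rotation_nonconstant_near:
  assumes d: "0 < d" and M: "M \<in> quadrant" and e: "0 < e"
  shows "\<exists>M'\<in>quadrant. dist M' M < e \<and> rotation d M' \<noteq> rotation d M"
proof (rule ccontr)
  assume "\<not> ?thesis"
  then have const: "rotation d p = rotation d M" if "p \<in> quadrant" "dist p M < e" for p using that by blast
  obtain u where u: "0 < u" "ball M u \<subseteq> quadrant" using open_quadrant M open_contains_ball by blast
  define B where "B = ball M (min u e)"
  have B: "B \<subseteq> quadrant" "M \<in> B" using u e by (auto simp: B_def)
  obtain M' where M': "dist M' M < min u e" "energy d M' \<noteq> energy d M"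
    using energy_nonconstant_near[OF d M] u(1) e by (metis min_less_iff_conj)
  have "M' \<in> B" using M'(1) by (simp add: B_def dist_commute)
  define a b where "a = min (energy d M) (energy d M')" and "b = max (energy d M) (energy d M')"
  have ab: "a < b" using M'(2) by (auto simp: a_def b_def)
  have "M' \<in> quadrant" using B \<open>M' \<in> B\<close> by blast
  then have a0: "0 < a" using energy_pos[OF d M] energy_pos[OF d] by (simp add: a_def)
  have "connected (energy d ` B)"
    by (intro connected_continuous_image continuous_on_subset[OF continuous_on_energy B(1)]) (simp add: B_def)
  then have "{a..b} \<subseteq> energy d ` B"
    by (rule connected_contains_Icc) (use B \<open>M' \<in> B\<close> in \<open>auto simp: a_def b_def min_def max_def\<close>)
  define \<rho> where "\<rho> = rotation d M"
  let ?w = "left_integral d" and ?g = "right_integral d"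
  have lin: "(2 - 3 * \<rho>) * ?w k = (4 * \<rho> - 2) * ?g k" and pos: "0 < ?w k" "0 < ?g k" if k: "k \<in> {a..b}" for k
  proof -
    have k0: "0 < k" using k a0 by simp
    obtain p where p: "p \<in> B" "k = energy d p" using k \<open>{a..b} \<subseteq> energy d ` B\<close> by blast
    have "dist p M < e" using p(1) by (simp add: B_def dist_commute)
    then have "rotation d p = \<rho>" unfolding \<rho>_def using const p B(1) by blast
    then have "2 * step_time d k / period d k = \<rho>" by (simp add: rotation_def p(2))
    then have "2 * step_time d k = \<rho> * period d k" using period_pos[OF d k0] by (simp add: field_simps)
    then show "(2 - 3 * \<rho>) * ?w k = (4 * \<rho> - 2) * ?g k"
      by (simp add: period_def step_time_eq[OF d k0] four_step_time_eq_left_integral[OF d k0] algebra_simps)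
    show "0 < ?w k" "0 < ?g k"
      using four_step_time_bounds[OF d k0] by (simp_all add: step_time_eq[OF d k0] four_step_time_eq_left_integral[OF d k0])
  qed
  \<comment> \<open>If \<open>2 - 3 \<rho>\<close> vanished, \<open>lin\<close> would force the right integral to vanish.\<close>
  have ne: "2 - 3 * \<rho> \<noteq> 0"
  proof
    assume "2 - 3 * \<rho> = 0"
    then have "(4 * \<rho> - 2) * ?g a = 0" "4 * \<rho> - 2 \<noteq> 0" using lin[of a] ab by simp_all
    then show False using pos[of a] ab by simp
  qed
  define c where "c = (4 * \<rho> - 2) / (2 - 3 * \<rho>)"
  have c: "?w k = c * ?g k" if "k \<in> {a..b}" for k using lin[OF that] ne by (simp add: c_def field_simps)
  have "0 < c * ?g a" using c[of a] pos[of a] ab by simp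
  then have "0 < c" using pos(2)[of a] ab by (simp add: zero_less_mult_iff)
  show False
    by (rule left_right_ratio_nonconstant[OF d a0 ab _ \<open>0 < c\<close>]) (use c in auto)
qed

lemma continuous_on_times_of_energy:
  assumes d: "0 < d"
  shows "continuous_on quadrant (\<lambda>p. step_time d (energy d p))" "continuous_on quadrant (\<lambda>p. period d (energy d p))"
proof -
  have im: "energy d ` quadrant \<subseteq> {0<..}" using energy_pos[OF d] by auto
  have w: "continuous_on quadrant (\<lambda>p. left_integral d (energy d p))"
    by (rule continuous_on_compose2[OF continuous_on_left_integral[OF d] continuous_on_energy im])
  have g: "continuous_on quadrant (\<lambda>p. right_integral d (energy d p))"
    by (rule continuous_on_compose2[OF continuous_on_right_integral[OF d] continuous_on_energy im])
  have s: "step_time d (energy d p) = left_integral d (energy d p) + right_integral d (energy d p)"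
    "period d (energy d p) = 3 * left_integral d (energy d p) + 4 * right_integral d (energy d p)"
    if "p \<in> quadrant" for p
    using energy_pos[OF d that] by (simp_all add: period_def step_time_eq[OF d] four_step_time_eq_left_integral[OF d])
  show "continuous_on quadrant (\<lambda>p. step_time d (energy d p))"
    by (rule continuous_on_eq[of _ "\<lambda>p. left_integral d (energy d p) + right_integral d (energy d p)"])
       (use s w g in \<open>auto intro!: continuous_intros\<close>)
  show "continuous_on quadrant (\<lambda>p. period d (energy d p))"
    by (rule continuous_on_eq[of _ "\<lambda>p. 3 * left_integral d (energy d p) + 4 * right_integral d (energy d p)"])
       (use s w g in \<open>auto intro!: continuous_intros\<close>)
qed

lemma F_iterate_eq_flow:
  assumes d: "0 < d" and p: "p \<in> quadrant"
  shows "(F d ^^ n) p = flow d p (n * rotation d p * period d (energy d p))"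
proof -
  have "(F d ^^ n) p = (step d ^^ (2 * n)) p"
  proof (induction n)
    case (Suc n)
    then show ?case using F_eq_step_step[OF d step_iterate(1)[OF d p], of "2 * n"] by simp
  qed simp
  also have "\<dots> = flow d p (real (2 * n) * step_time d (energy d p))" by (rule flow_step[OF d p, symmetric])
  also have "real (2 * n) * step_time d (energy d p) = n * rotation d p * period d (energy d p)"
    using period_pos[OF d energy_pos[OF d p]] by (simp add: rotation_def)
  finally show ?thesis .
qed

section \<open>Sensitivity of twisted rotations\<close>

text \<open>Let \<open>3 \<delta>\<close> be the smallest displacement that a phase shift by \<open>\<theta>\<close> causes on the orbits of points of \<open>K\<close>. For
\<open>M'\<close> close to \<open>M\<close> the curves \<open>\<Gamma> s M\<close> and \<open>\<Gamma> s M'\<close> differ by less than \<open>\<delta>\<close> for all \<open>s\<close>, by periodicity. If the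
rotation numbers of \<open>M\<close> and \<open>M'\<close> differ by a small \<open>t > 0\<close>, then the phase difference \<open>n t\<close> of the \<open>n\<close>-th
iterates comes close to \<open>\<theta>\<close> modulo \<open>1\<close> for infinitely many \<open>n\<close>; at such times the iterates are at
least \<open>3 \<delta> - \<delta> - \<delta>\<close> apart.\<close>
lemma sensitivity_of_twisted_rotation:
  fixes \<Gamma> :: "real \<Rightarrow> 'a::euclidean_space \<Rightarrow> 'a" and r :: "'a \<Rightarrow> real"
  assumes Q: "open Q" and K: "compact K" "K \<subseteq> Q"
    and cont: "continuous_on ({0..} \<times> Q) (\<lambda>(s, p). \<Gamma> s p)"
    and per: "\<And>s p. 0 \<le> s \<Longrightarrow> p \<in> Q \<Longrightarrow> \<Gamma> (s + 1) p = \<Gamma> s p"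
    and \<theta>: "0 < \<theta>" "\<And>s p. 0 \<le> s \<Longrightarrow> p \<in> K \<Longrightarrow> \<Gamma> (s + \<theta>) p \<noteq> \<Gamma> s p"
    and r: "continuous_on Q r" "\<And>p. p \<in> Q \<Longrightarrow> 0 \<le> r p"
    and twist: "\<And>M e. M \<in> K \<Longrightarrow> 0 < e \<Longrightarrow> \<exists>M'\<in>Q. dist M' M < e \<and> r M' \<noteq> r M"
  shows "\<exists>\<delta>>0. \<forall>M\<in>K. \<forall>W. W \<subseteq> Q \<and> M \<in> interior W \<longrightarrow>
      (\<exists>M'\<in>W. infinite {n::nat. \<delta> \<le> dist (\<Gamma> (n * r M) M) (\<Gamma> (n * r M') M')})"
proof (cases "K = {}")
  case False
  have pern: "\<Gamma> (s + real n) p = \<Gamma> s p" if "0 \<le> s" "p \<in> Q" for s p and n :: nat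
    by (induction n) (use per[OF _ that(2)] that in \<open>auto simp: add.assoc[symmetric] add.commute[of 1]\<close>)
  have reduce: "\<exists>n::nat. real n \<le> s \<and> s < real n + 1" if "0 \<le> s" for s :: real
    using that by (intro exI[of _ "nat \<lfloor>s\<rfloor>"] conjI; linarith)
  define h where "h = (\<lambda>(s, p). dist (\<Gamma> (s + \<theta>) p) (\<Gamma> s p))"
  have c1: "continuous_on ({0..1} \<times> K) (\<lambda>(s, p). \<Gamma> (s + \<theta>) p)"
  proof -
    have "continuous_on ({0..1} \<times> K) (\<lambda>x. (fst x + \<theta>, snd x))" by (intro continuous_intros)
    moreover have "(\<lambda>x. (fst x + \<theta>, snd x)) ` ({0..1} \<times> K) \<subseteq> {0..} \<times> Q" using \<theta>(1) K(2) by auto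
    ultimately have "continuous_on ({0..1} \<times> K) (\<lambda>x. (\<lambda>(s, p). \<Gamma> s p) (fst x + \<theta>, snd x))"
      by (rule continuous_on_compose2[OF cont])
    then show ?thesis by (simp add: case_prod_unfold)
  qed
  have c2: "continuous_on ({0..1} \<times> K) (\<lambda>(s, p). \<Gamma> s p)"
    by (rule continuous_on_subset[OF cont]) (use K(2) in auto)
  have hc: "continuous_on ({0..1} \<times> K) h"
    using c1 c2 unfolding h_def case_prod_unfold by (rule continuous_on_dist)
  have "compact ({0..1::real} \<times> K)" using K by (intro compact_Times compact_Icc)
  moreover have "{0..1::real} \<times> K \<noteq> {}" using False by simp
  ultimately have "\<exists>z\<in>{0..1} \<times> K. \<forall>y\<in>{0..1} \<times> K. h z \<le> h y"
    using hc by (rule continuous_attains_inf)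
  then obtain z where z: "z \<in> {0..1} \<times> K" "\<forall>y\<in>{0..1} \<times> K. h z \<le> h y"
    by (rule bexE)
  define \<delta> where "\<delta> = h z / 3"
  have \<delta>: "0 < \<delta>" using z(1) \<theta>(2) by (auto simp: \<delta>_def h_def)
  have sep: "3 * \<delta> \<le> dist (\<Gamma> (s + \<theta>) p) (\<Gamma> s p)" if s: "0 \<le> s" "p \<in> K" for s p
  proof -
    obtain n :: nat where n: "real n \<le> s" "s < real n + 1" using reduce[OF s(1)] by blast
    have "h z \<le> h (s - n, p)" using n s by (intro bspec[OF z(2)]) auto
    moreover have "\<Gamma> (s - n + \<theta>) p = \<Gamma> (s + \<theta>) p" "\<Gamma> (s - n) p = \<Gamma> s p"
      using pern[of "s - n + \<theta>" p n] pern[of "s - n" p n] n s K(2) \<theta>(1) by (auto simp: algebra_simps)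
    ultimately show ?thesis by (simp add: h_def \<delta>_def)
  qed
  show ?thesis
  proof (intro exI conjI ballI allI impI)
    show "0 < \<delta>" by (rule \<delta>)
    fix M W assume M: "M \<in> K" and W: "W \<subseteq> Q \<and> M \<in> interior W"
    have MQ: "M \<in> Q" using M K by blast
    have "compact {0..2::real}" by simp
    moreover have "continuous_on {0..2} (\<lambda>s. \<Gamma> s M)"
    proof -
      have "continuous_on {0..2} (\<lambda>s. (s, M))" by (intro continuous_intros)
      moreover have "(\<lambda>s. (s, M)) ` {0..2} \<subseteq> {0..} \<times> Q" using MQ by auto
      ultimately have "continuous_on {0..2} (\<lambda>s. (\<lambda>(s, p). \<Gamma> s p) (s, M))"
        by (rule continuous_on_compose2[OF cont])
      then show ?thesis by simp
    qed
    ultimately have "uniformly_continuous_on {0..2} (\<lambda>s. \<Gamma> s M)" by (intro compact_uniformly_continuous)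
    then obtain \<eta>0 where \<eta>0: "0 < \<eta>0"
      "\<And>s s'. s \<in> {0..2} \<Longrightarrow> s' \<in> {0..2} \<Longrightarrow> dist s' s < \<eta>0 \<Longrightarrow> dist (\<Gamma> s' M) (\<Gamma> s M) < \<delta>"
      unfolding uniformly_continuous_on_def using \<delta> by metis
    define \<eta> where "\<eta> = min \<eta>0 1"
    have \<eta>: "0 < \<eta>" "\<eta> \<le> 1" "\<eta> \<le> \<eta>0" using \<eta>0 by (auto simp: \<eta>_def)
    have near: "dist (\<Gamma> s' M) (\<Gamma> s M) < \<delta>" if s: "0 \<le> s" "s \<le> s'" "s' < s + \<eta>" for s s'
    proof -
      obtain n :: nat where n: "real n \<le> s" "s < real n + 1" using reduce[OF s(1)] by blast
      have "dist (\<Gamma> (s' - n) M) (\<Gamma> (s - n) M) < \<delta>"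
        by (rule \<eta>0(2)) (use n s \<eta> in \<open>auto simp: dist_real_def\<close>)
      then show ?thesis
        using pern[of "s' - n" M n] pern[of "s - n" M n] n s MQ by simp
    qed
    obtain \<rho> where \<rho>: "0 < \<rho>" "cball M \<rho> \<subseteq> Q" using Q MQ open_contains_cball by blast
    have "compact ({0..1::real} \<times> cball M \<rho>)" by (intro compact_Times compact_Icc compact_cball)
    moreover have "continuous_on ({0..1} \<times> cball M \<rho>) (\<lambda>(s, p). \<Gamma> s p)"
      by (rule continuous_on_subset[OF cont]) (use \<rho> in auto)
    ultimately have "uniformly_continuous_on ({0..1} \<times> cball M \<rho>) (\<lambda>(s, p). \<Gamma> s p)"
      by (intro compact_uniformly_continuous)
    then obtain \<epsilon> where \<epsilon>: "0 < \<epsilon>"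
      "\<And>x x'. x \<in> {0..1} \<times> cball M \<rho> \<Longrightarrow> x' \<in> {0..1} \<times> cball M \<rho> \<Longrightarrow> dist x' x < \<epsilon> \<Longrightarrow>
         dist ((\<lambda>(s, p). \<Gamma> s p) x') ((\<lambda>(s, p). \<Gamma> s p) x) < \<delta>"
      unfolding uniformly_continuous_on_def using \<delta> by metis
    have close: "dist (\<Gamma> s p) (\<Gamma> s M) < \<delta>" if s: "0 \<le> s" "dist p M < min \<epsilon> \<rho>" for s p
    proof -
      obtain n :: nat where n: "real n \<le> s" "s < real n + 1" using reduce[OF s(1)] by blast
      have pQ: "p \<in> Q" using \<rho> s by (auto simp: dist_commute)
      have "dist (\<Gamma> (s - n) p) (\<Gamma> (s - n) M) < \<delta>"
        using \<epsilon>(2)[of "(s - n, M)" "(s - n, p)"] s n \<rho> by (auto simp: dist_prod_def dist_commute)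
      then show ?thesis
        using pern[of "s - n" M n] pern[of "s - n" p n] n s MQ pQ by simp
    qed
    obtain \<kappa> where \<kappa>: "0 < \<kappa>" "\<And>p. p \<in> Q \<Longrightarrow> dist p M < \<kappa> \<Longrightarrow> dist (r p) (r M) < \<eta>"
      using r(1) MQ \<eta>(1) unfolding continuous_on_iff by metis
    obtain \<omega> where \<omega>: "0 < \<omega>" "ball M \<omega> \<subseteq> W" using W by (auto simp: mem_interior)
    have "0 < min (min \<epsilon> \<rho>) (min \<kappa> \<omega>)" using \<epsilon> \<rho> \<kappa> \<omega> by simp
    then obtain M' where M': "M' \<in> Q" "dist M' M < min (min \<epsilon> \<rho>) (min \<kappa> \<omega>)" "r M' \<noteq> r M"
      using twist[OF M] by blast
    define a b where "a = min (r M) (r M')" and "b = max (r M) (r M')"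
    define t where "t = b - a"
    have t: "0 < t" "t < \<eta>" using \<kappa>(2)[OF M'(1)] M' by (auto simp: t_def a_def b_def dist_real_def)
    have a0: "0 \<le> a" using r(2) MQ M'(1) by (simp add: a_def)
    show "\<exists>M'\<in>W. infinite {n::nat. \<delta> \<le> dist (\<Gamma> (n * r M) M) (\<Gamma> (n * r M') M')}"
    proof (intro bexI)
      show "M' \<in> W" using \<omega> M' by (auto simp: dist_commute)
      show "infinite {n::nat. \<delta> \<le> dist (\<Gamma> (n * r M) M) (\<Gamma> (n * r M') M')}"
        unfolding infinite_nat_iff_unbounded_le
      proof
        fix m :: nat
        \<comment> \<open>The first \<open>n\<close> with \<open>n t \<ge> m + \<theta>\<close>; there \<open>n t\<close> overshoots \<open>m + \<theta>\<close> by less than \<open>t < \<eta>\<close>.\<close>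
        define n where "n = nat \<lceil>(m + \<theta>) / t\<rceil>"
        have "0 < (m + \<theta>) / t" using t \<theta>(1) by (simp add: add_nonneg_pos)
        then have n: "(m + \<theta>) / t \<le> n" "n < (m + \<theta>) / t + 1" unfolding n_def by linarith+
        have nt: "m + \<theta> \<le> n * t" "n * t < m + \<theta> + t" using n t by (simp_all add: field_simps)
        have "real m \<le> real n"
        proof -
          have "n * t \<le> real n * 1" using t \<eta> by (intro mult_left_mono) auto
          then show ?thesis using nt \<theta>(1) by simp
        qed
        have nb: "n * b = n * a + n * t" by (simp add: t_def algebra_simps)
        have na: "0 \<le> n * a" using a0 by simp
        have "\<Gamma> (n * a + \<theta> + m) M = \<Gamma> (n * a + \<theta>) M" using pern[of "n * a + \<theta>" M m] na \<theta>(1) MQ by simp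
        then have "dist (\<Gamma> (n * b) M) (\<Gamma> (n * a + \<theta>) M) < \<delta>"
          using near[of "n * a + \<theta> + m" "n * b"] nb nt na t \<theta>(1) by simp
        then have "2 * \<delta> \<le> dist (\<Gamma> (n * b) M) (\<Gamma> (n * a) M)"
          using sep[OF na M] dist_triangle3[of "\<Gamma> (n * a + \<theta>) M" "\<Gamma> (n * a) M" "\<Gamma> (n * b) M"] by linarith
        then have "2 * \<delta> \<le> dist (\<Gamma> (n * r M) M) (\<Gamma> (n * r M') M)"
          by (auto simp: a_def b_def min_def max_def dist_commute split: if_splits)
        moreover have "dist (\<Gamma> (n * r M') M') (\<Gamma> (n * r M') M) < \<delta>"
          by (rule close) (use r(2)[OF M'(1)] M' in auto)
        ultimately have "\<delta> \<le> dist (\<Gamma> (n * r M) M) (\<Gamma> (n * r M') M')"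
          using dist_triangle2[of "\<Gamma> (n * r M) M" "\<Gamma> (n * r M') M" "\<Gamma> (n * r M') M'"]
          by (simp add: dist_commute)
        then show "\<exists>n\<ge>m. n \<in> {n::nat. \<delta> \<le> dist (\<Gamma> (n * r M) M) (\<Gamma> (n * r M') M')}"
          using \<open>real m \<le> real n\<close> by auto
      qed
    qed
  qed
qed (auto intro: exI[of _ 1])

theorem theorem24:
  fixes d :: real
  assumes "0 < d"
  shows "\<forall>K. compact K \<and> K \<subseteq> quadrant \<and> L d \<notin> K \<longrightarrow>
    (\<exists>\<delta>>0. \<forall>M\<in>K. \<forall>W. W \<subseteq> quadrant \<and> M \<in> interior W \<longrightarrow>
      (\<exists>M'\<in>W. infinite {n::nat. dist ((F d ^^ n) M) ((F d ^^ n) M') \<ge> \<delta>}))"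
proof (intro allI impI)
  note d = \<open>0 < d\<close>
  fix K assume K: "compact K \<and> K \<subseteq> quadrant \<and> L d \<notin> K"
  define P where "P p = period d (energy d p)" for p
  define \<Gamma> where "\<Gamma> s p = flow d p (s * P p)" for s p
  have P: "0 < P p" if "p \<in> quadrant" for p
    using period_pos[OF d energy_pos[OF d that]] by (simp add: P_def)
  have ret: "flow d p (P p) = p" if "p \<in> quadrant" for p
    using flow_period[OF d that] by (simp add: P_def)
  obtain \<theta> :: real where \<theta>: "0 < \<theta>" "\<theta> \<notin> \<rat>"
  proof -
    have "\<rat> \<noteq> (UNIV :: real set)" using uncountable_UNIV_real countable_rat by metis
    then obtain x :: real where "x \<notin> \<rat>" by blast
    then show ?thesis using that[of "\<bar>x\<bar>"] by (cases "x = 0") (auto simp: abs_if)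
  qed
  have F: "(F d ^^ n) p = \<Gamma> (n * rotation d p) p" if "p \<in> quadrant" for n p
    using F_iterate_eq_flow[OF d that] by (simp add: \<Gamma>_def P_def)
  have "\<exists>\<delta>>0. \<forall>M\<in>K. \<forall>W. W \<subseteq> quadrant \<and> M \<in> interior W \<longrightarrow>
      (\<exists>M'\<in>W. infinite {n::nat. \<delta> \<le> dist (\<Gamma> (n * rotation d M) M) (\<Gamma> (n * rotation d M') M')})"
  proof (rule sensitivity_of_twisted_rotation[OF open_quadrant])
    show "compact K" "K \<subseteq> quadrant" using K by auto
    have "continuous_on ({0..} \<times> quadrant) (\<lambda>x. (fst x * P (snd x), snd x))"
      unfolding P_def
      by (intro continuous_intros continuous_on_compose2[OF continuous_on_times_of_energy(2)[OF d]]) auto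
    moreover have "(\<lambda>x. (fst x * P (snd x), snd x)) ` ({0..} \<times> quadrant) \<subseteq> {0..} \<times> quadrant"
      using P by (auto intro!: mult_nonneg_nonneg simp: less_imp_le)
    ultimately have "continuous_on ({0..} \<times> quadrant) (\<lambda>x. (\<lambda>(t, p). flow d p t) (fst x * P (snd x), snd x))"
      by (rule continuous_on_compose2[OF continuous_on_flow[OF d]])
    then show "continuous_on ({0..} \<times> quadrant) (\<lambda>(s, p). \<Gamma> s p)"
      by (simp add: \<Gamma>_def case_prod_unfold)
    show "\<Gamma> (s + 1) p = \<Gamma> s p" if "0 \<le> s" "p \<in> quadrant" for s p
      using flow_add_return_time[OF d that(2) _ ret, of "s * P p" 1] P[OF that(2)] that
      by (simp add: \<Gamma>_def algebra_simps)
    show "0 < \<theta>" by (rule \<theta>(1))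
    show "\<Gamma> (s + \<theta>) p \<noteq> \<Gamma> s p" if s: "0 \<le> s" and p: "p \<in> K" for s p
    proof
      have pQ: "p \<in> quadrant" "p \<noteq> L d" using K p by auto
      assume eq: "\<Gamma> (s + \<theta>) p = \<Gamma> s p"
      \<comment> \<open>Flowing on to the next whole number of periods moves the coincidence to the point \<open>p\<close> itself.\<close>
      obtain n :: nat where n: "s \<le> n" using real_arch_simple by blast
      have "\<Gamma> (n + \<theta>) p = flow d (\<Gamma> (s + \<theta>) p) ((n - s) * P p)"
        unfolding \<Gamma>_def using flow_add[OF d pQ(1), of "(s + \<theta>) * P p" "(n - s) * P p"] s \<theta>(1) P[OF pQ(1)] n
        by (simp add: algebra_simps)
      also have "\<dots> = \<Gamma> n p"
        unfolding eq unfolding \<Gamma>_def using flow_add[OF d pQ(1), of "s * P p" "(n - s) * P p"] s P[OF pQ(1)] n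
        by (simp add: algebra_simps)
      finally have "flow d p (\<theta> * P p + n * P p) = flow d p (0 + n * P p)"
        by (simp add: \<Gamma>_def algebra_simps)
      then have "flow d p (\<theta> * P p) = flow d p 0"
        using flow_add_return_time[OF d pQ(1) _ ret[OF pQ(1)], of "\<theta> * P p" n]
          flow_add_return_time[OF d pQ(1) _ ret[OF pQ(1)], of 0 n] \<theta>(1) P[OF pQ(1)] by simp
      then show False
        using flow_irrational_multiple_of_period[OF d pQ \<theta>] by (simp add: P_def flow_0[OF d pQ(1)])
    qed
    have "\<forall>p\<in>quadrant. period d (energy d p) \<noteq> 0" using P unfolding P_def by (metis less_irrefl)
    then show "continuous_on quadrant (rotation d)"
      unfolding rotation_def[abs_def] by (intro continuous_intros continuous_on_times_of_energy[OF d])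
    show "0 \<le> rotation d p" if "p \<in> quadrant" for p
      using P[OF that] four_step_time_bounds[OF d energy_pos[OF d that]] by (simp add: rotation_def P_def)
    show "\<exists>M'\<in>quadrant. dist M' M < e \<and> rotation d M' \<noteq> rotation d M" if "M \<in> K" "0 < e" for M e
      using rotation_nonconstant_near[OF d _ that(2)] K that(1) by blast
  qed
  then obtain \<delta> where \<delta>: "0 < \<delta>" "\<And>M W. M \<in> K \<Longrightarrow> W \<subseteq> quadrant \<Longrightarrow> M \<in> interior W \<Longrightarrow>
      \<exists>M'\<in>W. infinite {n::nat. \<delta> \<le> dist (\<Gamma> (n * rotation d M) M) (\<Gamma> (n * rotation d M') M')}"
    by blast
  show "\<exists>\<delta>>0. \<forall>M\<in>K. \<forall>W. W \<subseteq> quadrant \<and> M \<in> interior W \<longrightarrow>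
      (\<exists>M'\<in>W. infinite {n::nat. dist ((F d ^^ n) M) ((F d ^^ n) M') \<ge> \<delta>})"
  proof (intro exI[of _ \<delta>] conjI ballI allI impI \<delta>(1))
    fix M W assume M: "M \<in> K" and W: "W \<subseteq> quadrant \<and> M \<in> interior W"
    obtain M' where M': "M' \<in> W" "infinite {n::nat. \<delta> \<le> dist (\<Gamma> (n * rotation d M) M) (\<Gamma> (n * rotation d M') M')}"
      using \<delta>(2)[OF M] W by blast
    have "M \<in> quadrant" "M' \<in> quadrant" using M M' W K by auto
    then show "\<exists>M'\<in>W. infinite {n::nat. dist ((F d ^^ n) M) ((F d ^^ n) M') \<ge> \<delta>}"
      using M' by (intro bexI[of _ M']) (simp_all add: F)
  qed
qed

end
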